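(* Let $0<q<1$ and let $a,b,c,d\in\mathbb{C}$ satisfy $a,b,c,d\neq 0$, $abcd\neq q^{-m}$ for $m=0,1,2,\ldots$, and $\{a,b\}\cap\{a^{-1},b^{-1}\}=\emptyset$. Suppose that $$B_n(a,b,c,d)\in\mathbb{R}\ (n\ge 0),\qquad C_n(a,b,c,d)>0\ (n\ge 1),$$ and also $$B_n(qa,qb,c,d)\in\mathbb{R}\ (n\ge 0),\qquad C_n(qa,qb,c,d)>0\ (n\ge 1).$$ Assume moreover that $ab<0$. Then: (i) $cd$ is real and $cd<1$; (ii) all coefficients in the formulas $$E_{-n}=P_n-Q_n\quad(n\ge1),\qquad E_n=P_n-\frac{ab(1-q^n)(1-q^{n-1}cd)}{(1-q^nab)(1-q^{n-1}abcd)}\,Q_n\quad(n\ge0)$$ are real, i.e. $\dfrac{ab(1-q^n)(1-q^{n-1}cd)}{(1-q^nab)(1-q^{n-1}abcd)}\in\mathbb{R}$ for all $n\ge1$; (iii) the symmetric bilinear form $$\langle (g_1,g_2),(h_1,h_2)\rangle=\langle g_1,h_1\rangle_{a,b,c,d;q}-ab\,\frac{(1-ab)(1-qab)(1-ac)(1-ad)(1-bc)(1-bd)}{(1-abcd)(1-qabcd)}\,\langle g_2,h_2\rangle_{qa,qb,c,d;q}$$ on pairs of symmetric Laurent polynomials with real coefficients is positive definite.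
   Context: Pochhammer symbols: $(a;q)_n=\prod_{j=0}^{n-1}(1-aq^j)$, $(a_1,\ldots,a_r;q)_n=(a_1;q)_n\cdots(a_r;q)_n$. A Laurent polynomial $f[z]$ is symmetric if $f[z]=f[z^{-1}]$; it is identified with the ordinary polynomial $f(x)$ in $x=\frac12(z+z^{-1})$ by $f(\frac12(z+z^{-1}))=f[z]$. Monic Askey-Wilson polynomials: $$P_n[z]=P_n[z;a,b,c,d\mid q]=\frac{(ab,ac,ad;q)_n}{a^n(abcdq^{n-1};q)_n}\sum_{k=0}^n\frac{(q^{-n},q^{n-1}abcd,az,az^{-1};q)_k}{(ab,ac,ad,q;q)_k}q^k,$$ with the factor $(ab,ac,ad;q)_n$ multiplied through and cancelled against the denominators. This is a symmetric Laurent polynomial. Put $e_1=a+b+c+d$, $e_3=abc+abd+acd+bcd$, $e_4=abcd$. The coefficients of the three-term recurrence relation $(z+z^{-1})P_n=P_{n+1}+B_nP_n+C_nP_{n-1}$ are $$B_n(a,b,c,d)=q^{n-1}\frac{(1-q^n-q^{n+1})e_3+qe_1+q^{2n-1}e_3e_4-q^{n-1}(1+q-q^{n+1})e_1e_4}{(1-q^{2n-2}e_4)(1-q^{2n}e_4)}\quad(n\ge0),$$ $$C_n(a,b,c,d)=(1-q^{n-1}ab)(1-q^{n-1}ac)(1-q^{n-1}ad)(1-q^{n-1}bc)(1-q^{n-1}bd)(1-q^{n-1}cd)\,\frac{(1-q^n)(1-q^{n-2}e_4)}{(1-q^{2n-3}e_4)(1-q^{2n-2}e_4)^2(1-q^{2n-1}e_4)}\quad(n\ge1),$$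 where common factors are cancelled for $n=0$ in $B_n$ (so $B_0=(e_1-e_3)/(1-e_4)$) and for $n=1$ in $C_n$ (the factor $1-q^{-1}e_4$). When all $B_n$ are real and all $C_n>0$, Favard's theorem gives a positive Borel measure $\mu=\mu_{a,b,c,d;q}$ on $\mathbb{R}$ with $\mu(\mathbb{R})=1$ and $\int_{\mathbb{R}}P_m(x)P_n(x)\,d\mu(x)=h_n\delta_{m,n}$, $h_n=C_1C_2\cdots C_n$. One sets $\langle f,g\rangle_{a,b,c,d;q}=\int_{\mathbb{R}}f(x)g(x)\,d\mu(x)$ for symmetric Laurent polynomials $f,g$; equivalently, it is the unique bilinear form with $\langle P_m,P_n\rangle_{a,b,c,d;q}=h_n\delta_{m,n}$. The form $\langle\cdot,\cdot\rangle_{qa,qb,c,d;q}$ is the same with $(a,b,c,d)$ replaced by $(qa,qb,c,d)$. $Q_n[z]=a^{-1}b^{-1}z^{-1}(1-az)(1-bz)\,P_{n-1}[z;qa,qb,c,d\mid q]$ for $n\ge1$, with the convention $(1-q^n)Q_n=0$ for $n=0$. A Laurent polynomial $f$ corresponds to the pair $(f_1,f_2)$ of symmetric Laurent polynomials uniquely determined by $f[z]=f_1[z]+z^{-1}(1-az)(1-bz)f_2[z]$; via this identification the form in (iii) is the form for which the polynomials $E_n$, $n\in\mathbb{Z}$, are orthogonal. *)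

theory Defs
  imports
    Complex_Main
    "HOL-Library.Poly_Mapping"
    "HOL-Library.Product_Plus"
    "HOL-Library.Complex_Order"
begin

text \<open>
  \<^theory>\<open>HOL-Library.Complex_Order\<close> orders \<^typ>\<open>complex\<close> by
  \<open>x < y \<longleftrightarrow> Re x < Re y \<and> Im x = Im y\<close>, so \<open>0 < z\<close> states that \<open>z\<close> is real and positive.
\<close>

definition qpoch :: "'a::comm_ring_1 \<Rightarrow> 'a \<Rightarrow> nat \<Rightarrow> 'a" where
  "qpoch a q n = (\<Prod>j<n. 1 - a * q ^ j)"


subsection \<open>Laurent polynomials\<close>

text \<open>
  A Laurent polynomial is the finitely supported family of its coefficients. The
  multiplication of \<^theory>\<open>HOL-Library.Poly_Mapping\<close> is convolution along addition of the
  exponents, which makes this type the ring of Laurent polynomials in \<open>z\<close>.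
\<close>

type_synonym laurent = "int \<Rightarrow>\<^sub>0 complex"

abbreviation lconst :: "complex \<Rightarrow> laurent" where
  "lconst r \<equiv> Poly_Mapping.single 0 r"

abbreviation lmonom :: "complex \<Rightarrow> int \<Rightarrow> laurent" where
  "lmonom r k \<equiv> Poly_Mapping.single k r"

definition sym_laurent :: "laurent set" where
  "sym_laurent = {f. \<forall>k. Poly_Mapping.lookup f (- k) = Poly_Mapping.lookup f k}"

definition real_sym_laurent :: "laurent set" where
  "real_sym_laurent = {f \<in> sym_laurent. \<forall>k. Poly_Mapping.lookup f k \<in> \<real>}"


subsection \<open>Askey-Wilson polynomials and their recurrence coefficients\<close>

text \<open>
  The prefactor \<open>(ab,ac,ad;q)\<^sub>n\<close> is cancelled against the denominator
  \<open>(ab,ac,ad;q)\<^sub>k\<close> by means of \<open>(x;q)\<^sub>n = (x;q)\<^sub>k (x q\<^sup>k;q)\<^sub>n\<^sub>-\<^sub>k\<close>.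
\<close>

definition aw_P :: "complex \<Rightarrow> complex \<Rightarrow> complex \<Rightarrow> complex \<Rightarrow> complex \<Rightarrow> nat \<Rightarrow> laurent" where
  "aw_P q a b c d n =
     lconst (1 / (a ^ n * qpoch (a * b * c * d * q powi (int n - 1)) q n)) *
     (\<Sum>k\<le>n.
        lconst (qpoch (q powi (- int n)) q k * qpoch (q powi (int n - 1) * (a * b * c * d)) q k *
                (qpoch (a * b * q ^ k) q (n - k) * qpoch (a * c * q ^ k) q (n - k) *
                 qpoch (a * d * q ^ k) q (n - k)) / qpoch q q k * q ^ k) *
        (qpoch (lmonom a 1) (lconst q) k * qpoch (lmonom a (- 1)) (lconst q) k))"

definition aw_B :: "complex \<Rightarrow> complex \<Rightarrow> complex \<Rightarrow> complex \<Rightarrow> complex \<Rightarrow> nat \<Rightarrow> complex" where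
  "aw_B q a b c d n =
     (let e1 = a + b + c + d; e3 = a * b * c + a * b * d + a * c * d + b * c * d;
          e4 = a * b * c * d
      in if n = 0 then (e1 - e3) / (1 - e4)
         else q ^ (n - 1) *
           ((1 - q ^ n - q ^ (n + 1)) * e3 + q * e1 + q ^ (2 * n - 1) * e3 * e4
              - q ^ (n - 1) * (1 + q - q ^ (n + 1)) * e1 * e4) /
           ((1 - q ^ (2 * n - 2) * e4) * (1 - q ^ (2 * n) * e4)))"

text \<open>
  For \<open>n = 1\<close> the factor \<open>1 - q\<^sup>n\<^sup>-\<^sup>2 e4\<close> of the numerator cancels
  \<open>1 - q\<^sup>2\<^sup>n\<^sup>-\<^sup>3 e4\<close>. The value at \<open>n = 0\<close> is junk.
\<close>

definition aw_C :: "complex \<Rightarrow> complex \<Rightarrow> complex \<Rightarrow> complex \<Rightarrow> complex \<Rightarrow> nat \<Rightarrow> complex" where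
  "aw_C q a b c d n =
     (let e4 = a * b * c * d
      in (1 - q ^ (n - 1) * (a * b)) * (1 - q ^ (n - 1) * (a * c)) * (1 - q ^ (n - 1) * (a * d)) *
         (1 - q ^ (n - 1) * (b * c)) * (1 - q ^ (n - 1) * (b * d)) * (1 - q ^ (n - 1) * (c * d)) *
         (if n = 1
          then (1 - q) / ((1 - e4) ^ 2 * (1 - q * e4))
          else (1 - q ^ n) * (1 - q ^ (n - 2) * e4) /
            ((1 - q ^ (2 * n - 3) * e4) * (1 - q ^ (2 * n - 2) * e4) ^ 2 *
             (1 - q ^ (2 * n - 1) * e4))))"

definition aw_h :: "complex \<Rightarrow> complex \<Rightarrow> complex \<Rightarrow> complex \<Rightarrow> complex \<Rightarrow> nat \<Rightarrow> complex" where
  "aw_h q a b c d n = (\<Prod>k = 1..n. aw_C q a b c d k)"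


subsection \<open>Bilinear forms\<close>

definition bilinear_form_on ::
    "complex set \<Rightarrow> (complex \<Rightarrow> 'v \<Rightarrow> 'v) \<Rightarrow> 'v::plus set \<Rightarrow> ('v \<Rightarrow> 'v \<Rightarrow> complex) \<Rightarrow> bool" where
  "bilinear_form_on K scale V F \<longleftrightarrow>
     (\<forall>u\<in>V. \<forall>v\<in>V. \<forall>w\<in>V. F (u + v) w = F u w + F v w \<and> F w (u + v) = F w u + F w v) \<and>
     (\<forall>r\<in>K. \<forall>u\<in>V. \<forall>v\<in>V. F (scale r u) v = r * F u v \<and> F u (scale r v) = r * F u v)"

definition is_aw_form ::
    "complex \<Rightarrow> complex \<Rightarrow> complex \<Rightarrow> complex \<Rightarrow> complex \<Rightarrow> (laurent \<Rightarrow> laurent \<Rightarrow> complex) \<Rightarrow> bool"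
where
  "is_aw_form q a b c d F \<longleftrightarrow>
     bilinear_form_on UNIV (\<lambda>r f. lconst r * f) sym_laurent F \<and>
     (\<forall>m n. F (aw_P q a b c d m) (aw_P q a b c d n) = (if m = n then aw_h q a b c d n else 0))"

text \<open>
  Under the Favard conditions this is \<open>\<integral> f(x) g(x) d\<mu>(x)\<close> for the
  orthogonality measure \<open>\<mu>\<close>. Since \<open>aw_P\<close> is monic of degree \<open>n\<close>, these
  polynomials form a basis of \<^const>\<open>sym_laurent\<close>, so the form exists and is unique there; the
  value 0 elsewhere is a convention that makes the description definite.
\<close>

definition aw_form ::
    "complex \<Rightarrow> complex \<Rightarrow> complex \<Rightarrow> complex \<Rightarrow> complex \<Rightarrow> laurent \<Rightarrow> laurent \<Rightarrow> complex" where
  "aw_form q a b c d =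
     (THE F. is_aw_form q a b c d F \<and>
        (\<forall>f g. f \<notin> sym_laurent \<or> g \<notin> sym_laurent \<longrightarrow> F f g = 0))"

definition pair_form ::
    "complex \<Rightarrow> complex \<Rightarrow> complex \<Rightarrow> complex \<Rightarrow> complex \<Rightarrow>
     laurent \<times> laurent \<Rightarrow> laurent \<times> laurent \<Rightarrow> complex" where
  "pair_form q a b c d u v =
     aw_form q a b c d (fst u) (fst v) -
     a * b * ((1 - a * b) * (1 - q * a * b) * (1 - a * c) * (1 - a * d) * (1 - b * c) * (1 - b * d) /
              ((1 - a * b * c * d) * (1 - q * a * b * c * d))) *
     aw_form q (q * a) (q * b) c d (snd u) (snd v)"

definition positive_definite_form_on ::
    "(complex \<Rightarrow> 'v \<Rightarrow> 'v) \<Rightarrow> 'v::{plus,zero} set \<Rightarrow> ('v \<Rightarrow> 'v \<Rightarrow> complex) \<Rightarrow> bool" where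
  "positive_definite_form_on scale V F \<longleftrightarrow>
     (\<forall>u\<in>V. \<forall>v\<in>V. F u v \<in> \<real> \<and> F u v = F v u) \<and>
     bilinear_form_on \<real> scale V F \<and>
     (\<forall>u\<in>V. u \<noteq> 0 \<longrightarrow> 0 < F u u)"

end

theory Submission
  imports Defs
begin

text \<open>
  The numbers \<open>C\<^sub>n\<^sub>+\<^sub>1(a,b,c,d)\<close> and \<open>C\<^sub>n(qa,qb,c,d)\<close> have
  almost all factors in common. As both are positive and \<open>ab < 0\<close>, their quotient shows that
  the numbers \<open>s\<^sub>n = (1 - q\<^sup>n cd) / (1 - q\<^sup>n abcd)\<close> have positive successive
  ratios; as they tend to 1, all of them are positive
  (\<open>positive_limit_of_positive_ratios\<close>). Positivity of \<open>s\<^sub>0\<close> together with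
  \<open>ab < 0\<close> forces \<open>cd\<close> to be real with \<open>cd < 1\<close> and \<open>abcd < 1\<close>
  (\<open>cd_real_of_positive_coefficients\<close>). The coefficients of \<open>Q\<^sub>n\<close> are
  then visibly real, and the weight of the second summand in the form on pairs is a positive
  multiple of \<open>C\<^sub>1(a,b,c,d)\<close>.

  It remains to see that each of the two forms is positive definite on real symmetric Laurent
  polynomials. Each is diagonal in a basis of monic polynomials \<open>P\<^sub>n\<close> with positive
  entries \<open>h\<^sub>n\<close>, so it suffices that the coordinates of a real polynomial are
  real, and hence that all \<open>P\<^sub>n\<close> are real
  (\<open>diag_form_positive_definite\<close>). As single parameters may be complex, the defining series
  does not show that \<open>P\<^sub>n\<close> has real coefficients. This follows from the three-term
  recurrence (\<open>aw_P_recurrence\<close>), and so does the fact that \<open>P\<^sub>n\<close> is monic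
  and symmetric. The recurrence is derived from the series by comparing coefficients in the basis
  \<open>(az, a/z; q)\<^sub>k\<close>, in which multiplication by
  \<open>z + z\<^sup>-\<^sup>1\<close> is bidiagonal; each comparison is one polynomial identity in
  \<open>a, b, c, d, q, q\<^sup>n, q\<^sup>k\<close> (\<open>contiguous_coefficient\<close>).
\<close>

section \<open>Laurent polynomials and shifted factorials\<close>

lemma lookup_lmonom_times:
  "Poly_Mapping.lookup (lmonom r j * f) k = r * Poly_Mapping.lookup f (k - j)"
proof -
  have "Poly_Mapping.lookup (lmonom r j * f) k =
      Sum_any (\<lambda>l. (r * Poly_Mapping.lookup f (k - l)) when l = j)"
    unfolding lookup_mult
  proof (intro Sum_any.cong)
    fix l
    have "(k = l + i) = (i = k - l)" for i by auto
    then show "Poly_Mapping.lookup (lmonom r j) l *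
        Sum_any (\<lambda>i. Poly_Mapping.lookup f i when k = l + i) =
        ((r * Poly_Mapping.lookup f (k - l)) when l = j)"
      by (simp add: lookup_single when_def)
  qed
  then show ?thesis by simp
qed

definition zsum :: laurent where "zsum = lmonom 1 1 + lmonom 1 (-1)"

lemma lookup_zsum_times:
  "Poly_Mapping.lookup (zsum * f) k = Poly_Mapping.lookup f (k - 1) + Poly_Mapping.lookup f (k + 1)"
  by (simp add: zsum_def distrib_right lookup_add lookup_lmonom_times)

lemma sym_laurent_add: "f \<in> sym_laurent \<Longrightarrow> g \<in> sym_laurent \<Longrightarrow> f + g \<in> sym_laurent"
  by (simp add: sym_laurent_def lookup_add)

lemma sym_laurent_scale: "f \<in> sym_laurent \<Longrightarrow> lconst r * f \<in> sym_laurent"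
  by (simp add: sym_laurent_def lookup_lmonom_times)

lemma lconst_simps:
  "lconst (x + y) = lconst x + lconst y"
  "lconst (x - y) = lconst x - lconst y"
  "lconst (x * y) = lconst x * lconst y"
  "lconst 1 = 1" "lconst 0 = 0" "lconst (- x) = - lconst x"
  by (auto simp: single_add single_diff mult_single single_one single_uminus)

lemma lconst_power: "lconst (x ^ n) = lconst x ^ n"
  by (induction n) (simp_all add: lconst_simps)

lemma qpoch_0 [simp]: "qpoch a q 0 = 1"
  by (simp add: qpoch_def)

lemma qpoch_Suc: "qpoch a q (Suc n) = qpoch a q n * (1 - a * q ^ n)"
  by (simp add: qpoch_def)

lemma qpoch_Suc': "qpoch a q (Suc n) = (1 - a) * qpoch (a * q) q n"
  unfolding qpoch_def prod.lessThan_Suc_shift by (simp add: mult.assoc)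

lemma qpoch_add: "qpoch a q (m + n) = qpoch a q m * qpoch (a * q ^ m) q n"
  by (induction n) (simp_all add: qpoch_Suc power_add mult.assoc)

lemma qpoch_nonzero:
  fixes a q :: complex
  assumes "\<And>m. 1 - a * q ^ m \<noteq> 0"
  shows "qpoch a q n \<noteq> 0"
  using assms by (simp add: qpoch_def)

section \<open>Forms diagonal in a monic symmetric basis\<close>

text \<open>
  The hypotheses express that the transition matrix from \<open>P\<close> to the basis
  \<open>1\<close>, \<open>z\<^sup>k + z\<^sup>-\<^sup>k\<close> of the symmetric Laurent polynomials is
  unitriangular. Consequently \<open>P\<close> is a basis, and back substitution needs no division, so that
  a real polynomial has real coordinates as soon as all \<open>P n\<close> are real.
\<close>

locale monic_sym_family =
  fixes P :: "nat \<Rightarrow> laurent"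
  assumes sym: "P n \<in> sym_laurent"
    and monic: "Poly_Mapping.lookup (P n) (int n) = 1"
    and degree: "int n < k \<Longrightarrow> Poly_Mapping.lookup (P n) k = 0"
begin

definition expands :: "laurent \<Rightarrow> nat \<Rightarrow> (nat \<Rightarrow> complex) \<Rightarrow> bool" where
  "expands f N c \<longleftrightarrow> (\<forall>n\<ge>N. c n = 0) \<and> f = (\<Sum>n<N. lconst (c n) * P n)"

text \<open>
  Back substitution: subtracting the multiple of \<open>P N\<close> that cancels the top coefficient
  lowers the degree. The bound \<open>N\<close> is strict, so that the induction starts at the zero
  polynomial; symmetry is what makes the coefficients of negative powers vanish along with the
  positive ones.
\<close>

lemma expansion_exists_bounded:
  assumes "f \<in> sym_laurent" "\<And>k. int N \<le> k \<Longrightarrow> Poly_Mapping.lookup f k = 0"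
  shows "\<exists>c. expands f N c \<and>
    (f \<in> real_sym_laurent \<longrightarrow> (\<forall>n. P n \<in> real_sym_laurent) \<longrightarrow> (\<forall>n. c n \<in> \<real>))"
  using assms
proof (induction N arbitrary: f)
  case 0
  have "Poly_Mapping.lookup f k = 0" for k
  proof (cases "k \<ge> 0")
    case True
    with 0 show ?thesis by simp
  next
    case False
    with 0 have "Poly_Mapping.lookup f (- k) = 0" by simp
    with 0(1) show ?thesis by (simp add: sym_laurent_def)
  qed
  then have "f = 0" by (intro poly_mapping_eqI) simp
  then show ?case
    by (intro exI[of _ "\<lambda>_. 0"]) (simp add: expands_def)
next
  case (Suc N)
  define r where "r = Poly_Mapping.lookup f (int N)"
  define g where "g = f - lconst r * P N"
  have gl: "Poly_Mapping.lookup g k = Poly_Mapping.lookup f k - r * Poly_Mapping.lookup (P N) k" for k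
    by (simp add: g_def lookup_minus lookup_lmonom_times)
  have "g \<in> sym_laurent"
    using Suc.prems(1) sym[of N] by (simp add: sym_laurent_def gl)
  moreover have "Poly_Mapping.lookup g k = 0" if "int N \<le> k" for k
  proof (cases "k = int N")
    case True
    then show ?thesis by (simp add: gl monic r_def)
  next
    case False
    with that have "int N < k" "int (Suc N) \<le> k" by auto
    then show ?thesis by (simp add: gl degree Suc.prems(2))
  qed
  ultimately obtain c where c: "expands g N c"
    and cr: "g \<in> real_sym_laurent \<longrightarrow> (\<forall>n. P n \<in> real_sym_laurent) \<longrightarrow> (\<forall>n. c n \<in> \<real>)"
    using Suc.IH by blast
  have "f = lconst r * P N + (\<Sum>n<N. lconst (c n) * P n)"
    using c by (simp add: expands_def g_def algebra_simps)
  then have "expands f (Suc N) (c(N := r))"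
    using c by (simp add: expands_def add.commute)
  moreover have "(c(N := r)) n \<in> \<real>"
    if "f \<in> real_sym_laurent" "\<forall>n. P n \<in> real_sym_laurent" for n
  proof -
    have "g \<in> real_sym_laurent"
      using that \<open>g \<in> sym_laurent\<close> by (simp add: real_sym_laurent_def gl r_def)
    with cr that show ?thesis by (simp add: real_sym_laurent_def r_def)
  qed
  ultimately show ?case by blast
qed

lemma expansion_exists:
  assumes "f \<in> sym_laurent"
  shows "\<exists>N c. expands f N c \<and>
    (f \<in> real_sym_laurent \<longrightarrow> (\<forall>n. P n \<in> real_sym_laurent) \<longrightarrow> (\<forall>n. c n \<in> \<real>))"
proof -
  obtain M where M: "\<And>k. k \<in> Poly_Mapping.keys f \<Longrightarrow> k \<le> M"
    using bdd_above_finite[OF finite_keys[of f]] by (auto simp: bdd_above_def)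
  have "Poly_Mapping.lookup f k = 0" if "int (nat (M + 1)) \<le> k" for k
    using M[of k] that by (cases "k \<in> Poly_Mapping.keys f") (auto simp: in_keys_iff split: if_splits)
  from expansion_exists_bounded[OF assms this] show ?thesis by blast
qed

lemma expands_mono:
  assumes "expands f N c" "N \<le> M"
  shows "expands f M c"
proof -
  have "(\<Sum>n<M. lconst (c n) * P n) = (\<Sum>n<N. lconst (c n) * P n)"
    using assms by (intro sum.mono_neutral_right) (auto simp: expands_def)
  with assms show ?thesis by (simp add: expands_def)
qed

text \<open>
  The coefficient of \<open>z\<^sup>N\<close> in a combination of \<open>P 0, \<dots>, P N\<close> sees only the
  last term.
\<close>

lemma independent:
  assumes "(\<Sum>n<N. lconst (c n) * P n) = 0" "m < N"
  shows "c m = 0"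
  using assms
proof (induction N)
  case (Suc N)
  have "0 = Poly_Mapping.lookup (\<Sum>n<Suc N. lconst (c n) * P n) (int N)"
    using Suc.prems by simp
  also have "\<dots> = (\<Sum>n<N. c n * Poly_Mapping.lookup (P n) (int N)) + c N"
    by (simp add: lookup_add lookup_sum lookup_lmonom_times monic)
  also have "(\<Sum>n<N. c n * Poly_Mapping.lookup (P n) (int N)) = 0"
    by (intro sum.neutral) (simp add: degree)
  finally have "c N = 0" by simp
  with Suc show ?case by (cases "m = N") auto
qed simp

lemma expands_unique:
  assumes "expands f N c" "expands f N' c'"
  shows "c = c'"
proof
  fix n
  define M where "M = max (Suc n) (max N N')"
  have "expands f M c" "expands f M c'"
    using assms by (auto intro: expands_mono simp: M_def)
  then have "(\<Sum>n<M. lconst (c n - c' n) * P n) = 0"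
    by (simp add: expands_def lconst_simps left_diff_distrib sum_subtractf)
  from independent[OF this, of n] show "c n = c' n" by (simp add: M_def)
qed

definition coord :: "laurent \<Rightarrow> nat \<Rightarrow> complex" where
  "coord f = (THE c. \<exists>N. expands f N c)"

lemma coord_eq: "expands f N c \<Longrightarrow> coord f = c"
  unfolding coord_def by (rule the_equality) (auto intro: expands_unique)

lemma expands_coord:
  assumes "f \<in> sym_laurent"
  obtains N where "expands f N (coord f)"
  using expansion_exists[OF assms] coord_eq by blast

lemma coord_real:
  assumes "f \<in> real_sym_laurent" "\<And>n. P n \<in> real_sym_laurent"
  shows "coord f n \<in> \<real>"
proof -
  have "f \<in> sym_laurent" using assms(1) by (simp add: real_sym_laurent_def)
  from expansion_exists[OF this] show ?thesis using assms coord_eq by blast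
qed

lemma coord_add:
  assumes "f \<in> sym_laurent" "g \<in> sym_laurent"
  shows "coord (f + g) = (\<lambda>n. coord f n + coord g n)"
proof -
  obtain N M where "expands f N (coord f)" "expands g M (coord g)"
    using assms by (metis expands_coord)
  then have "expands f (max N M) (coord f)" "expands g (max N M) (coord g)"
    by (auto intro: expands_mono)
  then have "expands (f + g) (max N M) (\<lambda>n. coord f n + coord g n)"
    by (simp add: expands_def lconst_simps distrib_right sum.distrib)
  then show ?thesis by (rule coord_eq)
qed

lemma coord_scale:
  assumes "f \<in> sym_laurent"
  shows "coord (lconst r * f) = (\<lambda>n. r * coord f n)"
proof -
  obtain N where N: "expands f N (coord f)"
    using assms by (metis expands_coord)
  then have "lconst r * f = lconst r * (\<Sum>n<N. lconst (coord f n) * P n)"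
    by (simp add: expands_def)
  also have "\<dots> = (\<Sum>n<N. lconst (r * coord f n) * P n)"
    by (simp add: lconst_simps sum_distrib_left mult.assoc)
  finally have "expands (lconst r * f) N (\<lambda>n. r * coord f n)"
    using N by (simp add: expands_def)
  then show ?thesis by (rule coord_eq)
qed

lemma coord_basis: "coord (P m) = (\<lambda>n. if n = m then 1 else 0)"
proof (rule coord_eq)
  have "(\<Sum>n<Suc m. lconst (if n = m then 1 else 0) * P n) = (\<Sum>n<Suc m. if n = m then P m else 0)"
    by (intro sum.cong) (auto simp: lconst_simps)
  then show "expands (P m) (Suc m) (\<lambda>n. if n = m then 1 else 0)"
    by (simp add: expands_def)
qed

text \<open>
  The series has only finitely many nonzero terms; an infinite sum avoids choosing a degree bound
  for each argument.
\<close>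

definition diag_form :: "(nat \<Rightarrow> complex) \<Rightarrow> laurent \<Rightarrow> laurent \<Rightarrow> complex" where
  "diag_form h f g =
     (if f \<in> sym_laurent \<and> g \<in> sym_laurent then suminf (\<lambda>n. coord f n * coord g n * h n) else 0)"

lemma summable_coord:
  assumes "f \<in> sym_laurent"
  shows "summable (\<lambda>n. coord f n * x n)"
proof -
  obtain N where "expands f N (coord f)" using assms by (rule expands_coord)
  then show ?thesis
    by (intro summable_finite[of "{..<N}"]) (auto simp: expands_def)
qed

lemma diag_form_commute: "diag_form h f g = diag_form h g f"
  by (simp add: diag_form_def mult_ac)

lemma diag_form_add:
  assumes "f \<in> sym_laurent" "g \<in> sym_laurent" "k \<in> sym_laurent"
  shows "diag_form h (f + g) k = diag_form h f k + diag_form h g k"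
  using assms summable_coord[of _ "\<lambda>n. coord k n * h n"]
  by (simp add: diag_form_def sym_laurent_add coord_add distrib_right suminf_add mult.assoc)

lemma diag_form_scale:
  assumes "f \<in> sym_laurent" "g \<in> sym_laurent"
  shows "diag_form h (lconst r * f) g = r * diag_form h f g"
  using assms summable_coord[of _ "\<lambda>n. coord g n * h n"]
  by (simp add: diag_form_def sym_laurent_scale coord_scale suminf_mult mult.assoc)

lemma bilinear_diag_form: "bilinear_form_on UNIV (\<lambda>r f. lconst r * f) sym_laurent (diag_form h)"
  unfolding bilinear_form_on_def using diag_form_add diag_form_scale diag_form_commute by metis

lemma diag_form_basis: "diag_form h (P m) (P n) = (if m = n then h n else 0)"
proof -
  have "diag_form h (P m) (P n) = (\<Sum>k\<in>{n}. (if k = m then 1 else 0) * (if k = n then 1 else 0) * h k)"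
    unfolding diag_form_def coord_basis
        using sym by (simp only: simp_thms if_True) (intro suminf_finite, auto)
  then show ?thesis by auto
qed

lemma bilinear_form_sum:
  assumes F: "bilinear_form_on UNIV (\<lambda>r f. lconst r * f) sym_laurent F" and g: "g \<in> sym_laurent"
  shows "F (\<Sum>n<N. lconst (c n) * P n) g = (\<Sum>n<N. c n * F (P n) g)"
    "F g (\<Sum>n<N. lconst (c n) * P n) = (\<Sum>n<N. c n * F g (P n))"
proof -
  have z: "0 \<in> sym_laurent" by (simp add: sym_laurent_def)
  have s: "(\<Sum>n<N. lconst (c n) * P n) \<in> sym_laurent" for N
    by (induction N) (auto intro: z sym_laurent_add sym_laurent_scale sym)
  have "F (lconst 0 * 0) g = 0 * F 0 g" "F g (lconst 0 * 0) = 0 * F g 0"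
    using F g z unfolding bilinear_form_on_def by blast+
  then have z': "F 0 g = 0" "F g 0 = 0" by simp_all
  have add: "F (f + f') g = F f g + F f' g" "F g (f + f') = F g f + F g f'"
    if "f \<in> sym_laurent" "f' \<in> sym_laurent" for f f'
    using F g that unfolding bilinear_form_on_def by blast+
  have sc: "F (lconst r * P n) g = r * F (P n) g" "F g (lconst r * P n) = r * F g (P n)" for r n
    using F g sym unfolding bilinear_form_on_def by blast+
  show "F (\<Sum>n<N. lconst (c n) * P n) g = (\<Sum>n<N. c n * F (P n) g)"
    by (induction N) (simp_all add: z' add s sc sym_laurent_scale sym)
  show "F g (\<Sum>n<N. lconst (c n) * P n) = (\<Sum>n<N. c n * F g (P n))"
    by (induction N) (simp_all add: z' add s sc sym_laurent_scale sym)
qed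

lemma bilinear_form_eq:
  assumes F: "bilinear_form_on UNIV (\<lambda>r f. lconst r * f) sym_laurent F"
    and G: "bilinear_form_on UNIV (\<lambda>r f. lconst r * f) sym_laurent G"
    and eq: "\<And>m n. F (P m) (P n) = G (P m) (P n)"
    and f: "f \<in> sym_laurent" and g: "g \<in> sym_laurent"
  shows "F f g = G f g"
proof -
  obtain N M where N: "f = (\<Sum>n<N. lconst (coord f n) * P n)"
      and M: "g = (\<Sum>n<M. lconst (coord g n) * P n)"
    using f g expands_coord unfolding expands_def by metis
  have 1: "F (P n) g = G (P n) g" for n
    by (subst (1 2) M) (simp add: bilinear_form_sum[OF F sym] bilinear_form_sum[OF G sym] eq)
  show ?thesis
    by (subst (1 2) N) (simp add: bilinear_form_sum[OF F g] bilinear_form_sum[OF G g] 1)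
qed

text \<open>
  A bilinear form on the span of a basis is determined by its values on pairs of basis elements, so
  the definite description picks out the diagonal form.
\<close>

lemma the_orthogonal_form:
  "(THE F. (bilinear_form_on UNIV (\<lambda>r f. lconst r * f) sym_laurent F \<and>
       (\<forall>m n. F (P m) (P n) = (if m = n then h n else 0))) \<and>
       (\<forall>f g. f \<notin> sym_laurent \<or> g \<notin> sym_laurent \<longrightarrow> F f g = 0)) = diag_form h"
proof (rule the_equality)
  fix F
  assume F: "(bilinear_form_on UNIV (\<lambda>r f. lconst r * f) sym_laurent F \<and>
       (\<forall>m n. F (P m) (P n) = (if m = n then h n else 0))) \<and>
       (\<forall>f g. f \<notin> sym_laurent \<or> g \<notin> sym_laurent \<longrightarrow> F f g = 0)"
  show "F = diag_form h"
  proof (intro ext)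
    fix f g
    show "F f g = diag_form h f g"
    proof (cases "f \<in> sym_laurent \<and> g \<in> sym_laurent")
      case True
      then show ?thesis
        using F bilinear_form_eq[of F "diag_form h" f g] bilinear_diag_form[of h] diag_form_basis[of h] by simp
    next
      case False
      with F show ?thesis by (auto simp: diag_form_def)
    qed
  qed
next
  have "diag_form h f g = 0" if "f \<notin> sym_laurent \<or> g \<notin> sym_laurent" for f g
    using that by (auto simp: diag_form_def)
  then show "(bilinear_form_on UNIV (\<lambda>r f. lconst r * f) sym_laurent (diag_form h) \<and>
       (\<forall>m n. diag_form h (P m) (P n) = (if m = n then h n else 0))) \<and>
       (\<forall>f g. f \<notin> sym_laurent \<or> g \<notin> sym_laurent \<longrightarrow> diag_form h f g = 0)"
    using bilinear_diag_form diag_form_basis by blast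
qed

text \<open>
  In real coordinates the form is \<open>\<Sum>n. c\<^sub>n\<^sup>2 h\<^sub>n\<close>.
\<close>

lemma diag_form_positive_definite:
  assumes "\<And>n. P n \<in> real_sym_laurent" and "\<And>n. 0 < h n"
  shows "positive_definite_form_on (\<lambda>r f. lconst r * f) real_sym_laurent (diag_form h)"
  unfolding positive_definite_form_on_def
proof (intro conjI ballI impI)
  have sub: "f \<in> sym_laurent" if "f \<in> real_sym_laurent" for f
    using that by (simp add: real_sym_laurent_def)
  have hr: "h n \<in> \<real>" for n
    using assms(2)[of n] by (simp add: complex_is_Real_iff less_complex_def)
  have cr: "coord f n \<in> \<real>" if "f \<in> real_sym_laurent" for f n
    using coord_real[OF that assms(1)] .
  have fin: "\<exists>N. expands f N (coord f) \<and> diag_form h f g = (\<Sum>n<N. coord f n * coord g n * h n)"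
    if fg: "f \<in> real_sym_laurent" "g \<in> real_sym_laurent" for f g
  proof -
    obtain N where N: "expands f N (coord f)" using sub[OF fg(1)] by (rule expands_coord)
    then have "suminf (\<lambda>n. coord f n * coord g n * h n) = (\<Sum>n<N. coord f n * coord g n * h n)"
      by (intro suminf_finite) (auto simp: expands_def)
    with N fg sub show ?thesis by (auto simp: diag_form_def)
  qed
  show "diag_form h f g \<in> \<real>" if "f \<in> real_sym_laurent" "g \<in> real_sym_laurent" for f g
    using fin[OF that] cr that hr by (auto intro!: sum_in_Reals Reals_mult)
  show "diag_form h f g = diag_form h g f" for f g by (rule diag_form_commute)
  show "bilinear_form_on \<real> (\<lambda>r f. lconst r * f) real_sym_laurent (diag_form h)"
    using bilinear_diag_form[of h] sub unfolding bilinear_form_on_def by blast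
  show "0 < diag_form h f f" if f: "f \<in> real_sym_laurent" and "f \<noteq> 0" for f
  proof -
    obtain N where N: "expands f N (coord f)" and eq: "diag_form h f f =
        (\<Sum>n<N. coord f n * coord f n * h n)"
      using fin[OF f f] by blast
    have "\<exists>n<N. coord f n \<noteq> 0"
    proof (rule ccontr)
      assume "\<not> ?thesis"
      then have "(\<Sum>n<N. lconst (coord f n) * P n) = 0" by (intro sum.neutral) (auto simp: lconst_simps)
      with N \<open>f \<noteq> 0\<close> show False by (simp add: expands_def)
    qed
    then obtain m where m: "m < N" "coord f m \<noteq> 0" by blast
    have sq: "coord f n * coord f n * h n = of_real ((Re (coord f n))\<^sup>2 * Re (h n))" for n
      using cr[OF f, of n] hr[of n]
      by (metis of_real_Re of_real_mult power2_eq_square)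
    have "0 < (\<Sum>n<N. (Re (coord f n))\<^sup>2 * Re (h n))"
    proof (rule sum_pos2[where i = m])
      show "0 < (Re (coord f m))\<^sup>2 * Re (h m)"
        using m cr[OF f, of m] assms(2)[of m]
        by (auto simp: less_complex_def complex_is_Real_iff complex_eq_iff)
      show "0 \<le> (Re (coord f n))\<^sup>2 * Re (h n)" for n
        using assms(2)[of n] by (simp add: less_complex_def)
    qed (use m in auto)
    then show ?thesis
      unfolding eq sq by (simp add: less_complex_def flip: of_real_sum)
  qed
qed

end

section \<open>The three-term recurrence\<close>

text \<open>
  With \<open>x = q\<^sup>n\<^sup>-\<^sup>1\<close> this is
  \<open>B\<^sub>n = a + a\<^sup>-\<^sup>1 - U\<^sub>n - D\<^sub>n\<close> with denominators cleared, where
  \<open>U\<^sub>n\<close> and \<open>D\<^sub>n\<close> multiply the next and the previous polynomial in the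
  recurrence for the \<open>\<^sub>4\<phi>\<^sub>3\<close> normalization. The right-hand side does not look symmetric in
  \<open>a, b, c, d\<close>, the left-hand side shows that it is.
\<close>

lemma recurrence_coefficient_B:
  fixes a b c d q x e1 e3 e4 :: complex
  assumes "e1 = a + b + c + d" "e3 = a * b * c + a * b * d + a * c * d + b * c * d"
    "e4 = a * b * c * d"
  shows "a * x*((1-q*x-q^2*x)*e3 + q*e1 + q*x^2*e3*e4 - x*(1+q-q^2*x)*e1*e4) * (1-q*x^2*e4)
   = (a^2+1)*(1-x^2*e4)*(1-q*x^2*e4)*(1-q^2*x^2*e4) -
       (1-a*b*q*x)*(1-a*c*q*x)*(1-a*d*q*x)*(1-x*e4)*(1-x^2*e4)
   - a^2*(1-q*x)*(1-b*c*x)*(1-b*d*x)*(1-c*d*x)*(1-q^2*x^2*e4)"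
  unfolding assms by algebra

text \<open>
  These are the conditions under which no denominator in the series for \<open>P\<^sub>n\<close> with the
  factors \<open>(ab,ac,ad;q)\<^sub>k\<close> not yet cancelled, or in the recurrence coefficients, can
  vanish.
\<close>

locale aw_params =
  fixes q a b c d :: complex
  assumes q_nonzero: "q \<noteq> 0" and a_nonzero: "a \<noteq> 0"
    and q_power: "1 - q * q ^ n \<noteq> 0"
    and ab: "1 - a * b * q ^ n \<noteq> 0"
    and ac: "1 - a * c * q ^ n \<noteq> 0"
    and ad: "1 - a * d * q ^ n \<noteq> 0"
    and abcd: "1 - a * b * c * d * q ^ n \<noteq> 0"
begin

abbreviation e4 :: complex where "e4 \<equiv> a * b * c * d"

definition phi :: "nat \<Rightarrow> laurent" where
  "phi k = qpoch (lmonom a 1) (lconst q) k * qpoch (lmonom a (- 1)) (lconst q) k"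

lemma phi_0 [simp]: "phi 0 = 1"
  by (simp add: phi_def)

lemma phi_Suc: "phi (Suc k) = (lconst (1 + (a * q ^ k)\<^sup>2) - lconst (a * q ^ k) * zsum) * phi k"
proof -
  have "(1 - lmonom a 1 * lconst q ^ k) * (1 - lmonom a (- 1) * lconst q ^ k) =
      1 - lmonom (a * q ^ k) 1 - lmonom (a * q ^ k) (- 1) + lconst ((a * q ^ k) * (a * q ^ k))"
    unfolding lconst_power[symmetric] mult_single by (simp add: algebra_simps mult_single)
  also have "\<dots> = lconst (1 + (a * q ^ k)\<^sup>2) - lconst (a * q ^ k) * zsum"
    by (simp add: zsum_def distrib_left mult_single power2_eq_square single_add)
  finally have f: "(1 - lmonom a 1 * lconst q ^ k) * (1 - lmonom a (- 1) * lconst q ^ k) = \<dots>" .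
  have "phi (Suc k) = ((1 - lmonom a 1 * lconst q ^ k) * (1 - lmonom a (- 1) * lconst q ^ k)) * phi k"
    by (simp only: phi_def qpoch_Suc mult_ac)
  then show ?thesis unfolding f .
qed

text \<open>
  Multiplication by \<open>z + z\<^sup>-\<^sup>1\<close> is bidiagonal in the basis
  \<open>(az, a/z; q)\<^sub>k\<close>, because
  \<open>(1 - tz)(1 - t/z) = 1 + t\<^sup>2 - t (z + z\<^sup>-\<^sup>1)\<close>. The shift by
  \<open>a + a\<^sup>-\<^sup>1\<close> makes the diagonal entry vanish for \<open>k = 0\<close>.
\<close>

lemma zsum_phi:
  "(lconst (a + 1 / a) - zsum) * phi k =
     lconst (a + 1 / a - a * q ^ k - 1 / (a * q ^ k)) * phi k + lconst (1 / (a * q ^ k)) * phi (Suc k)"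
proof -
  define t where "t = a * q ^ k"
  have "t \<noteq> 0" using a_nonzero q_nonzero by (simp add: t_def)
  have "lconst (1 / t) * (lconst (1 + t\<^sup>2) - lconst t * zsum) =
      lconst ((1 / t) * (1 + t\<^sup>2)) - lconst ((1 / t) * t) * zsum"
    by (simp only: lconst_simps right_diff_distrib mult.assoc)
  also have "\<dots> = lconst (t + 1 / t) - zsum"
    using \<open>t \<noteq> 0\<close> by (simp add: field_simps power2_eq_square)
  finally have "lconst (1 / t) * phi (Suc k) = (lconst (t + 1 / t) - zsum) * phi k"
    unfolding phi_Suc t_def[symmetric] mult.assoc[symmetric] by (rule arg_cong)
  moreover have "lconst (a + 1 / a - t - 1 / t) = lconst (a + 1 / a) - lconst (t + 1 / t)"
    by (simp only: lconst_simps(2)[symmetric] diff_diff_eq)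
  ultimately show ?thesis
    unfolding t_def[symmetric] by (simp only: left_diff_distrib) simp
qed

text \<open>
  For \<open>X = q\<^sup>n\<close> this is \<open>(q\<^sup>-\<^sup>n, q\<^sup>n\<^sup>-\<^sup>1abcd; q)\<^sub>k\<close>,
  the part of the \<open>k\<close>-th term that depends on \<open>n\<close>.
\<close>

definition num :: "complex \<Rightarrow> nat \<Rightarrow> complex" where
  "num X k = qpoch (1 / X) q k * qpoch (X * e4 / q) q k"

text \<open>
  The factors shared by \<open>num X\<close> and \<open>num (q * X)\<close>; the difference of these two is
  a simple multiple of it.
\<close>

definition mid :: "complex \<Rightarrow> nat \<Rightarrow> complex" where
  "mid X k = qpoch (1 / X) q k * qpoch (X * e4) q k"

definition wt :: "nat \<Rightarrow> complex" where
  "wt k = q ^ k / (qpoch (a * b) q k * qpoch (a * c) q k * qpoch (a * d) q k * qpoch q q k)"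

lemma wt_Suc:
  "wt k = wt (Suc k) * ((1 - a * b * q ^ k) * (1 - a * c * q ^ k) * (1 - a * d * q ^ k) *
    (1 - q * q ^ k)) / q"
proof -
  define F where "F = (1 - a * b * q ^ k) * (1 - a * c * q ^ k) * (1 - a * d * q ^ k) * (1 - q * q ^ k)"
  have "F \<noteq> 0" using ab[of k] ac[of k] ad[of k] q_power[of k] by (simp only: F_def mult_eq_0_iff) simp
  have "wt (Suc k) =
      q * q ^ k / ((qpoch (a * b) q k * qpoch (a * c) q k * qpoch (a * d) q k * qpoch q q k) * F)"
    unfolding wt_def qpoch_Suc F_def by (simp only: power_Suc mult_ac)
  then have "wt (Suc k) * F / q = wt k"
    using \<open>F \<noteq> 0\<close> q_nonzero by (simp add: wt_def)
  then show ?thesis unfolding F_def ..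
qed

lemma num_Suc: "num X (Suc k) = num X k * (1 - q ^ k / X) * (1 - X * e4 * q ^ k / q)"
  by (simp add: num_def qpoch_Suc)

text \<open>
  Both values are \<open>mid X k\<close> times a product of two linear factors in \<open>q\<^sup>k\<close>.
  The difference of the two products loses its constant term and factors completely, which is why
  the recurrence is best written in terms of differences of consecutive series.
\<close>

lemma num_diff:
  assumes "X \<noteq> 0"
  shows "num X (Suc k) - num (q * X) (Suc k) = (1 - q * q ^ k) * (1 - X\<^sup>2 * e4) / (q * X) * mid X k"
proof -
  have 1: "num (q * X) (Suc k) = (1 - 1 / (q * X)) * (1 - X * e4 * q ^ k) * mid X k"
    unfolding num_def mid_def qpoch_Suc'[of "1 / (q * X)"] qpoch_Suc[of "q * X * e4 / q"]
    using q_nonzero by (simp add: mult_ac)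
  have 2: "num X (Suc k) = (1 - q ^ k / X) * (1 - X * e4 / q) * mid X k"
    unfolding num_def mid_def qpoch_Suc[of "1 / X"] qpoch_Suc'[of "X * e4 / q"]
    using q_nonzero by (simp add: mult_ac)
  have "(1 - q ^ k / X) * (1 - X * e4 / q) - (1 - 1 / (q * X)) * (1 - X * e4 * q ^ k) =
      (1 - q * q ^ k) * (1 - X\<^sup>2 * e4) / (q * X)"
    using assms q_nonzero by (simp add: field_simps power2_eq_square)
  then show ?thesis unfolding 1 2 by (metis left_diff_distrib)
qed

lemma mid_up: "(1 - X * e4 / q) * mid X k = num X k * (1 - X * e4 * q ^ k / q)"
  using qpoch_Suc[of "X * e4 / q" q k] qpoch_Suc'[of "X * e4 / q" q k] q_nonzero
  by (simp add: num_def mid_def mult_ac)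

lemma mid_down:
  assumes "X \<noteq> 0"
  shows "(1 - X) * mid (X / q) k = - num X k * (X - q ^ k)"
proof -
  have "(1 - 1 / X) * mid (X / q) k = num X k * (1 - q ^ k / X)"
    using qpoch_Suc[of "1 / X" q k] qpoch_Suc'[of "1 / X" q k]
    by (simp add: num_def mid_def mult_ac)
  moreover have "(1 - X) * mid (X / q) k = - X * ((1 - 1 / X) * mid (X / q) k)"
    using assms by (simp add: field_simps)
  moreover have "- X * (num X k * (1 - q ^ k / X)) = - num X k * (X - q ^ k)"
    using assms by (simp add: field_simps)
  ultimately show ?thesis by metis
qed

text \<open>
  With \<open>x = q\<^sup>n\<^sup>-\<^sup>1\<close>, \<open>up x\<close> and \<open>down x\<close> are the
  coefficients of the next and the previous polynomial in the recurrence for the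
  \<open>\<^sub>4\<phi>\<^sub>3\<close> series with constant term 1. Using \<open>n - 1\<close> as the index
  avoids negative powers of \<open>q\<close>.
\<close>

definition up :: "complex \<Rightarrow> complex" where
  "up x = (1 - a * b * (q * x)) * (1 - a * c * (q * x)) * (1 - a * d * (q * x)) * (1 - x * e4) /
     (a * (1 - q * x\<^sup>2 * e4) * (1 - q\<^sup>2 * x\<^sup>2 * e4))"

definition down :: "complex \<Rightarrow> complex" where
  "down x = a * (1 - q * x) * (1 - b * c * x) * (1 - b * d * x) * (1 - c * d * x) /
     ((1 - x\<^sup>2 * e4) * (1 - q * x\<^sup>2 * e4))"

text \<open>
  The coefficient of \<open>(az, a/z; q)\<^sub>k\<^sub>+\<^sub>1\<close> in the recurrence. All terms are
  multiples of \<open>num (q * x) k * wt (Suc k)\<close>; after dividing by it, what remains is an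
  identity between polynomials in \<open>a, b, c, d, q, x\<close> and \<open>Y = q\<^sup>k\<close>.
\<close>

lemma contiguous_coefficient:
  assumes "x \<noteq> 0" "1 - x\<^sup>2 * e4 \<noteq> 0" "1 - q * x\<^sup>2 * e4 \<noteq> 0" "1 - q\<^sup>2 * x\<^sup>2 * e4 \<noteq> 0"
  shows "num (q * x) (Suc k) * wt (Suc k) * (a + 1 / a - a * q ^ Suc k - 1 / (a * q ^ Suc k)) +
      num (q * x) k * wt k / (a * q ^ k) =
      (up x * (num (q * x) (Suc k) - num (q * (q * x)) (Suc k)) - down x *
          (num x (Suc k) - num (q * x) (Suc k))) * wt (Suc k)"
proof -
  define X Y W V where "X = q * x" and "Y = q ^ k" and "W = wt (Suc k)" and "V = num X k"
  have nz: "X \<noteq> 0" "Y \<noteq> 0" using assms q_nonzero by (auto simp: X_def Y_def)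
  have xX: "X * e4 / q = x * e4" "X / q = x" "X * e4 * Y / q = x * Y * e4"
    using q_nonzero by (auto simp: X_def)
  let ?D = "1 - q * x\<^sup>2 * e4"
  define T where "T = (1 - a * b * X) * (1 - a * c * X) * (1 - a * d * X) / (a * q * X * ?D)"
  define R where "R = a * (1 - b * c * x) * (1 - b * d * x) * (1 - c * d * x) / (X * ?D)"
  have up: "up x * (num X (Suc k) - num (q * X) (Suc k)) = T * (1 - q * Y) * (V * (1 - x * Y * e4))"
  proof -
    have "X\<^sup>2 * e4 = q\<^sup>2 * x\<^sup>2 * e4" by (simp add: X_def power_mult_distrib)
    moreover have "V * (1 - x * Y * e4) = (1 - x * e4) * mid X k"
      using mid_up[of X k] xX by (simp add: V_def Y_def)
    ultimately show ?thesis
      unfolding num_diff[OF nz(1)] up_def T_def X_def[symmetric] Y_def[symmetric]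
      using assms(3,4) nz a_nonzero q_nonzero by (simp add: divide_simps)
  qed
  have down: "down x * (num x (Suc k) - num X (Suc k)) = - R * (1 - q * Y) * (V * (X - Y))"
  proof -
    have "V * (X - Y) = - ((1 - X) * mid x k)"
      using mid_down[OF nz(1), of k] xX by (simp add: V_def Y_def)
    moreover have "num x (Suc k) - num X (Suc k) = (1 - q * Y) * (1 - x\<^sup>2 * e4) / X * mid x k"
      using num_diff[OF assms(1), of k] by (simp add: X_def Y_def)
    ultimately show ?thesis
      unfolding down_def R_def X_def[symmetric]
      using assms(2,3) nz by (simp add: divide_simps)
  qed
  have gk: "a + 1 / a - a * q ^ Suc k - 1 / (a * q ^ Suc k) =
      - (1 - q * Y) * (1 - a\<^sup>2 * q * Y) / (a * q * Y)"
    using a_nonzero q_nonzero nz by (simp add: Y_def[symmetric] field_simps power2_eq_square)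
  have vS: "num X (Suc k) = V * (1 - Y / X) * (1 - x * Y * e4)"
    unfolding num_Suc V_def Y_def[symmetric] xX ..
  \<comment> \<open>the polynomial identity to which everything reduces\<close>
  have "?D * ((1 - a * b * Y) * (1 - a * c * Y) * (1 - a * d * Y) * X - (1 - a\<^sup>2 * q * Y) *
      (X - Y) * (1 - x * Y * e4)) =
      Y * (1 - a * b * X) * (1 - a * c * X) * (1 - a * d * X) * (1 - x * Y * e4) +
      a\<^sup>2 * q * Y * (1 - b * c * x) * (1 - b * d * x) * (1 - c * d * x) * (X - Y)"
    unfolding X_def by algebra
  then have key: "((1 - a * b * Y) * (1 - a * c * Y) * (1 - a * d * Y) * X - (1 - a\<^sup>2 * q * Y) *
      (X - Y) * (1 - x * Y * e4)) / (a * q * X * Y) =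
      T * (1 - x * Y * e4) + R * (X - Y)" (is "?L = ?R")
    unfolding T_def R_def using a_nonzero q_nonzero nz assms(3) by (simp add: divide_simps) algebra
  have "num X (Suc k) * W * (- (1 - q * Y) * (1 - a\<^sup>2 * q * Y) / (a * q * Y)) +
      V * (W * ((1 - a * b * Y) * (1 - a * c * Y) * (1 - a * d * Y) * (1 - q * Y)) / q) / (a * Y)
      = V * W * (1 - q * Y) * ?L"
    unfolding vS using a_nonzero q_nonzero nz by (simp add: divide_simps) algebra
  also have "\<dots> = V * W * (1 - q * Y) * ?R"
    unfolding key ..
  also have "\<dots> =
      (up x * (num X (Suc k) - num (q * X) (Suc k)) - down x * (num x (Suc k) - num X (Suc k))) * W"
    unfolding up down by (simp add: algebra_simps)
  finally show ?thesis
    unfolding gk wt_Suc[of k] X_def[symmetric] Y_def[symmetric] W_def[symmetric] V_def[symmetric] .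
qed

text \<open>
  The terminating \<open>\<^sub>4\<phi>\<^sub>3\<close> series, normalized to have constant term 1 in the
  basis \<open>phi\<close>.
\<close>

definition series :: "nat \<Rightarrow> laurent" where
  "series n = (\<Sum>k\<le>n. lconst (num (q ^ n) k * wt k) * phi k)"

lemma num_vanish:
  assumes "n < k"
  shows "num (q ^ n) k = 0"
proof -
  have "qpoch (1 / q ^ n) q k = 0"
    unfolding qpoch_def
  proof (rule prod_zero)
    show "\<exists>j\<in>{..<k}. 1 - 1 / q ^ n * q ^ j = 0"
      using assms q_nonzero by (intro bexI[of _ n]) auto
  qed simp
  then show ?thesis by (simp add: num_def)
qed

text \<open>
  The terms beyond \<open>n\<close> vanish, so series of different degree can be compared over one
  range of summation; splitting off \<open>k = 0\<close> makes the constant terms cancel in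
  differences.
\<close>

lemma series_extend:
  assumes "n \<le> N"
  shows "series n = 1 + (\<Sum>k<N. lconst (num (q ^ n) (Suc k) * wt (Suc k)) * phi (Suc k))"
proof -
  have "series n = (\<Sum>k\<le>N. lconst (num (q ^ n) k * wt k) * phi k)"
    unfolding series_def using assms
    by (intro sum.mono_neutral_left) (auto simp: num_vanish)
  also have "\<dots> = 1 + (\<Sum>k<N. lconst (num (q ^ n) (Suc k) * wt (Suc k)) * phi (Suc k))"
    by (simp add: sum.atMost_shift num_def wt_def lconst_simps)
  finally show ?thesis .
qed

lemma zsum_series:
  "(lconst (a + 1 / a) - zsum) * series n =
     (\<Sum>k<Suc n. lconst (num (q ^ n) (Suc k) * wt (Suc k) *
         (a + 1 / a - a * q ^ Suc k - 1 / (a * q ^ Suc k)) +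
        num (q ^ n) k * wt k / (a * q ^ k)) * phi (Suc k))"
proof -
  let ?u = "\<lambda>k. num (q ^ n) k * wt k" and ?g = "\<lambda>k. a + 1 / a - a * q ^ k - 1 / (a * q ^ k)"
  have "(lconst (a + 1 / a) - zsum) * series n =
      (\<Sum>k\<le>n. lconst (?u k) * ((lconst (a + 1 / a) - zsum) * phi k))"
    unfolding series_def sum_distrib_left by (simp add: mult_ac)
  also have "\<dots> = (\<Sum>k\<le>n. lconst (?u k * ?g k) * phi k + lconst (?u k / (a * q ^ k)) * phi (Suc k))"
    unfolding zsum_phi lconst_simps(3) distrib_left
    by (simp add: mult.assoc[symmetric] mult_single)
  also have "\<dots> =
      (\<Sum>k\<le>n. lconst (?u k * ?g k) * phi k) + (\<Sum>k<Suc n. lconst (?u k / (a * q ^ k)) * phi (Suc k))"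
    by (simp add: sum.distrib lessThan_Suc_atMost)
  also have "(\<Sum>k\<le>n. lconst (?u k * ?g k) * phi k) = (\<Sum>k\<le>Suc n. lconst (?u k * ?g k) * phi k)"
    by (simp add: num_vanish lconst_simps)
  also have "\<dots> = (\<Sum>k<Suc n. lconst (?u (Suc k) * ?g (Suc k)) * phi (Suc k))"
    unfolding sum.atMost_shift by simp
  finally show ?thesis
    by (simp only: sum.distrib[symmetric] lconst_simps(1) distrib_right)
qed

lemma nonzero_square:
  "1 - (q ^ m)\<^sup>2 * e4 \<noteq> 0" "1 - q * (q ^ m)\<^sup>2 * e4 \<noteq> 0" "1 - q\<^sup>2 * (q ^ m)\<^sup>2 * e4 \<noteq> 0"
proof -
  have sq: "(q ^ m)\<^sup>2 = q ^ (2 * m)" by (simp add: power_mult[symmetric] mult.commute)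
  have "e4 * q ^ Suc (2 * m) = q * (q ^ m)\<^sup>2 * e4" "e4 * q ^ Suc (Suc (2 * m)) = q\<^sup>2 * (q ^ m)\<^sup>2 * e4"
      "e4 * q ^ (2 * m) = (q ^ m)\<^sup>2 * e4"
    unfolding sq power2_eq_square[of q] power_Suc by (simp_all only: mult_ac)
  then show "1 - (q ^ m)\<^sup>2 * e4 \<noteq> 0" "1 - q * (q ^ m)\<^sup>2 * e4 \<noteq> 0" "1 - q\<^sup>2 * (q ^ m)\<^sup>2 * e4 \<noteq> 0"
    using abcd by metis+
qed

lemma contiguous:
  "(lconst (a + 1 / a) - zsum) * series (Suc m) =
     lconst (up (q ^ m)) * (series (Suc m) - series (Suc (Suc m))) - lconst (down (q ^ m)) *
         (series m - series (Suc m))"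
proof -
  let ?N = "Suc (Suc m)"
  let ?s = "\<lambda>f. \<Sum>k<?N. lconst (f k * wt (Suc k)) * phi (Suc k)"
  let ?num = "\<lambda>n k. num (q ^ n) (Suc k)"
  have lin: "lconst r * (?s f - ?s g) = ?s (\<lambda>k. r * (f k - g k))" for r f g
    unfolding sum_distrib_left sum_subtractf[symmetric]
    by (simp only: left_diff_distrib right_diff_distrib lconst_simps mult.assoc)
  have series: "series n = 1 + ?s (?num n)" if "n \<le> ?N" for n
    using series_extend[OF that] .
  have le: "m \<le> ?N" "Suc m \<le> ?N" "?N \<le> ?N" by auto
  have "lconst (up (q ^ m)) * (series (Suc m) - series ?N) - lconst (down (q ^ m)) *
      (series m - series (Suc m)) =
      ?s (\<lambda>k. up (q ^ m) * (?num (Suc m) k - ?num ?N k) - down (q ^ m) * (?num m k - ?num (Suc m) k))"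
    unfolding series[OF le(1)] series[OF le(2)] series[OF le(3)] add_diff_cancel_left lin
    by (simp only: sum_subtractf[symmetric] left_diff_distrib[symmetric] lconst_simps(2)[symmetric])
  also have "\<dots> =
      (\<Sum>k<?N. lconst (num (q ^ Suc m) (Suc k) * wt (Suc k) *
          (a + 1 / a - a * q ^ Suc k - 1 / (a * q ^ Suc k)) +
        num (q ^ Suc m) k * wt k / (a * q ^ k)) * phi (Suc k))"
    using contiguous_coefficient[of "q ^ m", OF _ nonzero_square] q_nonzero
    by (simp only: power_Suc power_not_zero simp_thms)
  also have "\<dots> = (lconst (a + 1 / a) - zsum) * series (Suc m)"
    unfolding zsum_series ..
  finally show ?thesis ..
qed

text \<open>
  The factor that makes \<open>series n\<close> monic.
\<close>

definition kappa :: "nat \<Rightarrow> complex" where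
  "kappa n = qpoch (a * b) q n * qpoch (a * c) q n * qpoch (a * d) q n /
     (a ^ n * qpoch (e4 * q powi (int n - 1)) q n)"

lemma aw_P_eq: "aw_P q a b c d n = lconst (kappa n) * series n"
proof -
  have ratio: "qpoch (y * q ^ k) q (n - k) = qpoch y q n / qpoch y q k"
    if "\<And>m. 1 - y * q ^ m \<noteq> 0" "k \<le> n" for y k
    using qpoch_add[of y q k "n - k"] that qpoch_nonzero[of y q k] by (simp add: field_simps)
  let ?D = "qpoch (a * b) q n * qpoch (a * c) q n * qpoch (a * d) q n"
  have pw: "q powi (- int n) = 1 / q ^ n" "q powi (int n - 1) * e4 = q ^ n * e4 / q"
    using q_nonzero by (simp_all add: power_int_minus power_int_diff divide_inverse)
  have "(\<Sum>k\<le>n.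
        lconst (qpoch (q powi (- int n)) q k * qpoch (q powi (int n - 1) * (a * b * c * d)) q k *
                (qpoch (a * b * q ^ k) q (n - k) * qpoch (a * c * q ^ k) q (n - k) *
                 qpoch (a * d * q ^ k) q (n - k)) / qpoch q q k * q ^ k) *
        (qpoch (lmonom a 1) (lconst q) k * qpoch (lmonom a (- 1)) (lconst q) k)) =
      (\<Sum>k\<le>n. lconst (?D * (num (q ^ n) k * wt k)) * phi k)"
  proof (rule sum.cong[OF refl])
    fix k assume "k \<in> {..n}"
    then have "k \<le> n" by simp
    note r = ratio[OF ab this] ratio[OF ac this] ratio[OF ad this]
    have "qpoch (1 / q ^ n) q k * qpoch (q ^ n * e4 / q) q k *
        (qpoch (a * b * q ^ k) q (n - k) * qpoch (a * c * q ^ k) q (n - k) *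
          qpoch (a * d * q ^ k) q (n - k)) / qpoch q q k * q ^ k = ?D * (num (q ^ n) k * wt k)"
      unfolding r num_def wt_def by simp
    then show "lconst (qpoch (q powi (- int n)) q k * qpoch (q powi (int n - 1) * (a * b * c * d)) q k *
                (qpoch (a * b * q ^ k) q (n - k) * qpoch (a * c * q ^ k) q (n - k) *
                 qpoch (a * d * q ^ k) q (n - k)) / qpoch q q k * q ^ k) *
        (qpoch (lmonom a 1) (lconst q) k * qpoch (lmonom a (- 1)) (lconst q) k) =
      lconst (?D * (num (q ^ n) k * wt k)) * phi k"
      unfolding pw phi_def by (simp only:)
  qed
  also have "\<dots> = lconst ?D * series n"
    unfolding series_def sum_distrib_left lconst_simps(3) mult.assoc ..
  finally show ?thesis
    unfolding aw_P_def kappa_def by (simp add: mult_single mult.assoc[symmetric])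
qed

lemma series_0: "series 0 = 1"
  using series_extend[of 0 0] by simp

lemma kappa_Suc:
  "kappa (Suc m) = qpoch (a * b) q (Suc m) * qpoch (a * c) q (Suc m) * qpoch (a * d) q (Suc m) /
     (a ^ Suc m * qpoch (e4 * q ^ m) q (Suc m))"
  by (simp add: kappa_def power_int_def)

lemma kappa_1: "kappa (Suc 0) = (1 - a * b) * (1 - a * c) * (1 - a * d) / (a * (1 - e4))"
  unfolding kappa_Suc by (simp add: qpoch_Suc)

lemma kappa_ratio: "kappa (Suc (Suc m)) = kappa (Suc m) * up (q ^ m)"
proof -
  define x where "x = q ^ m"
  define Q where "Q = qpoch (e4 * (q * x)) q (Suc m)"
  define R where "R = qpoch (e4 * x) q (Suc m)"
  define N where "N = qpoch (a * b) q (Suc m) * qpoch (a * c) q (Suc m) * qpoch (a * d) q (Suc m)"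
  note nz = nonzero_square[of m, folded x_def]
  have "R \<noteq> 0"
    unfolding R_def x_def
    using abcd by (auto intro!: qpoch_nonzero simp only: mult.assoc[of e4] power_add[symmetric])
  have "qpoch (e4 * x) q (Suc (Suc m)) = (1 - e4 * x) * Q"
    unfolding qpoch_Suc'[of _ _ "Suc m"] Q_def by (simp only: mult_ac)
  moreover have "qpoch (e4 * x) q (Suc (Suc m)) = R * (1 - q * x\<^sup>2 * e4)"
    unfolding qpoch_Suc[of _ _ "Suc m"] R_def power_Suc x_def[symmetric] power2_eq_square
        by (simp only: mult_ac)
  ultimately have QR: "R * (1 - q * x\<^sup>2 * e4) = (1 - e4 * x) * Q" by simp
  define F where "F = (1 - a * b * (q * x)) * (1 - a * c * (q * x)) * (1 - a * d * (q * x))"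
  define D1 D2 where "D1 = 1 - q * x\<^sup>2 * e4" and "D2 = 1 - q\<^sup>2 * x\<^sup>2 * e4"
  have k2: "kappa (Suc (Suc m)) = N * F / (a ^ Suc m * a * (Q * D2))"
    unfolding kappa_Suc[of "Suc m"] qpoch_Suc[of _ _ "Suc m"] N_def Q_def F_def D2_def power_Suc x_def[symmetric] power2_eq_square
    by (simp only: mult_ac)
  have k1: "kappa (Suc m) = N / (a ^ Suc m * R)"
    unfolding kappa_Suc N_def R_def x_def ..
  have "D1 \<noteq> 0" using nz by (simp add: D1_def)
  with QR \<open>R \<noteq> 0\<close> have "1 - e4 * x \<noteq> 0" unfolding D1_def by auto
  then have Q: "Q = R * D1 / (1 - x * e4)"
    using QR unfolding D1_def by (simp add: field_simps)
  show ?thesis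
    unfolding k2 k1 Q up_def x_def[symmetric] F_def[symmetric] D1_def[symmetric] D2_def[symmetric]
    by (simp add: mult_ac)
qed

text \<open>
  Passing to the monic normalization turns \<open>down\<close> into
  \<open>down (q ^ m) * kappa (Suc m) / kappa m\<close>. For \<open>m = 0\<close> the ratio of the
  \<open>kappa\<close> is not of the form \<open>up x\<close>: the factor
  \<open>1 - q\<^sup>-\<^sup>1abcd\<close> has been cancelled in it, as it has been in \<open>aw_C\<close>.
\<close>

lemma kappa_C: "aw_C q a b c d (Suc m) * kappa m = down (q ^ m) * kappa (Suc m)"
proof (cases m)
  case 0
  then show ?thesis
    by (simp add: kappa_1 qpoch_Suc aw_C_def down_def Let_def kappa_def power2_eq_square a_nonzero mult_ac)
next
  case (Suc k)
  define x where "x = q ^ k"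
  have e: "2 * Suc (Suc k) - 3 = Suc (2 * k)" "2 * Suc (Suc k) - 2 = Suc (Suc (2 * k))"
    "2 * Suc (Suc k) - 1 = Suc (Suc (Suc (2 * k)))" by auto
  have xx: "q ^ (2 * k) = x * x" by (simp add: x_def power_add[symmetric] mult_2)
  have "aw_C q a b c d (Suc m) = down (q ^ m) * up x"
    unfolding aw_C_def Let_def Suc e down_def up_def power_Suc xx
    using a_nonzero by (simp add: x_def[symmetric] power2_eq_square mult_ac)
  then show ?thesis
    unfolding Suc kappa_ratio x_def by (simp only: mult_ac)
qed

lemma aw_B_0: "aw_B q a b c d 0 = a + 1 / a - kappa (Suc 0)"
  unfolding kappa_1 aw_B_def Let_def using a_nonzero abcd[of 0]
  by (simp add: divide_simps) algebra

lemma aw_B_Suc: "aw_B q a b c d (Suc m) = a + 1 / a - up (q ^ m) - down (q ^ m)"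
proof -
  define x e1 e3 E where "x = q ^ m" and "e1 = a + b + c + d"
    and "e3 = a * b * c + a * b * d + a * c * d + b * c * d" and "E = e4"
  note nz = nonzero_square[of m, folded x_def E_def]
  define U where "U = x*((1-q*x-q^2*x)*e3 + q*e1 + q*x^2*e3*E - x*(1+q-q^2*x)*e1*E)"
  define V where "V = (1-a*b*(q*x))*(1-a*c*(q*x))*(1-a*d*(q*x))*(1-x*E)"
  define W where "W = (1-q*x)*(1-b*c*x)*(1-b*d*x)*(1-c*d*x)"
  define D0 D1 D2 where "D0 = 1 - x\<^sup>2 * E" and "D1 = 1 - q * x\<^sup>2 * E" and "D2 = 1 - q\<^sup>2 * x\<^sup>2 * E"
  have xx: "q ^ (2 * m) = x * x" by (simp add: x_def power_add[symmetric] mult_2)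
  have e: "2 * Suc m - 2 = 2 * m" "2 * Suc m - 1 = Suc (2 * m)" "2 * Suc m = Suc (Suc (2 * m))" by auto
  have B: "aw_B q a b c d (Suc m) = U / (D0 * D2)"
    unfolding aw_B_def Let_def U_def D0_def D2_def e power_Suc xx e1_def e3_def E_def
    by (simp add: x_def[symmetric] xx xx[unfolded mult.commute[of 2]] power2_eq_square mult_ac)
  have up: "up x = V / (a * D1 * D2)"
    unfolding up_def V_def D1_def D2_def E_def ..
  have down: "down x = a * W / (D0 * D1)"
    unfolding down_def W_def D0_def D1_def E_def by (simp only: mult_ac)
  have key: "a * U * D1 = (a\<^sup>2 + 1) * D0 * D1 * D2 - V * D0 - a\<^sup>2 * W * D2"
    using recurrence_coefficient_B[OF e1_def e3_def E_def, of x q]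
    unfolding U_def V_def W_def D0_def D1_def D2_def by (simp only: mult_ac)
  have nz': "D0 \<noteq> 0" "D1 \<noteq> 0" "D2 \<noteq> 0"
    unfolding D0_def D1_def D2_def using nz by auto
  have U: "U = ((a\<^sup>2 + 1) * D0 * D1 * D2 - V * D0 - a\<^sup>2 * W * D2) / (a * D1)"
    unfolding key[symmetric] using nz' a_nonzero by simp
  show ?thesis
    unfolding x_def[symmetric] B up down U using a_nonzero nz' by (simp add: divide_simps) algebra
qed

lemma aw_P_0: "aw_P q a b c d 0 = 1"
  unfolding aw_P_eq series_0 by (simp add: kappa_def)

text \<open>
  The start of the recurrence is computed directly, because \<open>contiguous\<close> begins at
  index 1.
\<close>

lemma aw_P_1: "aw_P q a b c d (Suc 0) = zsum - lconst (aw_B q a b c d 0)"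
proof -
  have k: "kappa (Suc 0) * (num q (Suc 0) * wt (Suc 0)) = - 1 / a"
    unfolding kappa_1 num_def wt_def qpoch_Suc
    using ab[of 0] ac[of 0] ad[of 0] abcd[of 0] q_power[of 0] a_nonzero q_nonzero
    by (simp add: divide_simps)
  have "aw_P q a b c d (Suc 0) =
      lconst (kappa (Suc 0)) + lconst (kappa (Suc 0) * (num q (Suc 0) * wt (Suc 0))) * phi (Suc 0)"
    unfolding aw_P_eq series_extend[of "Suc 0" "Suc 0", simplified] lconst_simps(3)[of "kappa (Suc 0)"]
    by (simp add: distrib_left mult.assoc)
  also have "\<dots> =
      lconst (kappa (Suc 0)) + (lconst ((- 1 / a) * (1 + a\<^sup>2)) - lconst ((- 1 / a) * a) * zsum)"
    unfolding k phi_Suc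
        by (simp only: lconst_simps(3) power_0 mult_1_right phi_0 right_diff_distrib mult.assoc)
  finally have P: "aw_P q a b c d (Suc 0) = \<dots>" .
  have e: "(- 1 / a) * (1 + a\<^sup>2) = - (a + 1 / a)" "(- 1 / a) * a = - 1"
    using a_nonzero by (auto simp: field_simps power2_eq_square)
  show ?thesis
    unfolding P e aw_B_0 lconst_simps by simp
qed

lemma aw_P_recurrence:
  "aw_P q a b c d (Suc (Suc m)) =
     zsum * aw_P q a b c d (Suc m) - lconst (aw_B q a b c d (Suc m)) * aw_P q a b c d (Suc m)
       - lconst (aw_C q a b c d (Suc m)) * aw_P q a b c d m"
proof -
  let ?k = "lconst (kappa (Suc m))" and ?up = "lconst (up (q ^ m))" and ?down = "lconst (down (q ^ m))"
  let ?L = "lconst (a + 1 / a)"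
  have "?k * ((?L - zsum) * series (Suc m)) =
      ?k * (?up * (series (Suc m) - series (Suc (Suc m))) - ?down * (series m - series (Suc m)))"
    unfolding contiguous ..
  then have "(?k * ?up) * series (Suc (Suc m)) =
      zsum * (?k * series (Suc m)) - (?L - ?up - ?down) * (?k * series (Suc m)) - (?down * ?k) *
          series m"
    by (simp only: left_diff_distrib right_diff_distrib mult_ac) (simp add: algebra_simps)
  moreover have "?k * ?up = lconst (kappa (Suc (Suc m)))"
    unfolding kappa_ratio by (simp add: mult_single)
  moreover have "?down * ?k = lconst (aw_C q a b c d (Suc m)) * lconst (kappa m)"
    unfolding lconst_simps(3)[symmetric] kappa_C ..
  moreover have "?L - ?up - ?down = lconst (aw_B q a b c d (Suc m))"
    unfolding aw_B_Suc lconst_simps(2) ..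
  ultimately show ?thesis
    unfolding aw_P_eq by (simp only: mult.assoc)
qed

end

section \<open>Real coefficients and positivity from the recurrence\<close>

lemma complex_pos_iff: "0 < z \<longleftrightarrow> (\<exists>r. 0 < r \<and> z = complex_of_real r)"
  by (auto simp: less_complex_def complex_eq_iff)

lemma complex_pos_mult: "0 < x \<Longrightarrow> 0 < y \<Longrightarrow> 0 < x * (y :: complex)"
  by (auto simp: less_complex_def)

lemma complex_pos_divide: "0 < x \<Longrightarrow> 0 < y \<Longrightarrow> 0 < x / (y :: complex)"
  by (auto simp: complex_pos_iff simp flip: of_real_divide)

lemma three_term_recurrence_monic_sym:
  assumes P0: "P 0 = 1" and P1: "P (Suc 0) = zsum - lconst (B 0)"
    and P2: "\<And>n. P (Suc (Suc n)) =
        zsum * P (Suc n) - lconst (B (Suc n)) * P (Suc n) - lconst (C (Suc n)) * P n"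
  shows "monic_sym_family P"
proof -
  let ?Q = "\<lambda>n. P n \<in> sym_laurent \<and> Poly_Mapping.lookup (P n) (int n) = 1 \<and>
    (\<forall>k>int n. Poly_Mapping.lookup (P n) k = 0)"
  have "?Q n \<and> ?Q (Suc n)" for n
  proof (induction n)
    case 0
    then show ?case
      by (auto simp: P0 P1 sym_laurent_def zsum_def lookup_one lookup_minus lookup_add
          lookup_single when_def)
  next
    case (Suc n)
    have l: "Poly_Mapping.lookup (P (Suc (Suc n))) k =
        Poly_Mapping.lookup (P (Suc n)) (k - 1) + Poly_Mapping.lookup (P (Suc n)) (k + 1)
        - B (Suc n) * Poly_Mapping.lookup (P (Suc n)) k - C (Suc n) * Poly_Mapping.lookup (P n) k" for k
      unfolding P2 by (simp add: lookup_minus lookup_zsum_times lookup_lmonom_times)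
    have s: "Poly_Mapping.lookup (P m) (- k) = Poly_Mapping.lookup (P m) k"
        if "m = n \<or> m = Suc n" for m k
      using Suc that by (auto simp: sym_laurent_def)
    have "Poly_Mapping.lookup (P (Suc (Suc n))) (- k) = Poly_Mapping.lookup (P (Suc (Suc n))) k" for k
      unfolding l using s[of "Suc n" "k + 1"] s[of "Suc n" "k - 1"] s[of "Suc n" k] s[of n k] by simp
    then have "P (Suc (Suc n)) \<in> sym_laurent" by (simp add: sym_laurent_def)
    moreover have "Poly_Mapping.lookup (P (Suc (Suc n))) (int (Suc (Suc n))) = 1"
      using Suc by (simp add: l add.commute)
    moreover have "Poly_Mapping.lookup (P (Suc (Suc n))) k = 0" if "k > int (Suc (Suc n))" for k
      using Suc that by (simp add: l)
    ultimately show ?case using Suc by blast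
  qed
  then show ?thesis by unfold_locales blast+
qed

lemma three_term_recurrence_real:
  assumes P0: "P 0 = 1" and P1: "P (Suc 0) = zsum - lconst (B 0)"
    and P2: "\<And>n. P (Suc (Suc n)) =
        zsum * P (Suc n) - lconst (B (Suc n)) * P (Suc n) - lconst (C (Suc n)) * P n"
    and B: "\<And>n. B n \<in> \<real>" and C: "\<And>n. C (Suc n) \<in> \<real>"
  shows "Poly_Mapping.lookup (P n) k \<in> \<real>"
proof -
  have "\<forall>k. Poly_Mapping.lookup (P n) k \<in> \<real> \<and> Poly_Mapping.lookup (P (Suc n)) k \<in> \<real>"
  proof (induction n)
    case 0
    then show ?case
      using B[of 0] by (auto simp: P0 P1 zsum_def lookup_one lookup_minus lookup_add
          lookup_single when_def)
  next
    case (Suc n)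
    then show ?case
      using B C unfolding P2 by (simp add: lookup_minus lookup_zsum_times lookup_lmonom_times)
  qed
  then show ?thesis by blast
qed

lemma aw_params_of_positive:
  fixes q :: real
  assumes "0 < q" "q < 1" "a \<noteq> 0"
    and e4: "\<And>m::nat. a * b * c * d \<noteq> complex_of_real q powi (- int m)"
    and C: "\<And>n. n \<ge> 1 \<Longrightarrow> 0 < aw_C (complex_of_real q) a b c d n"
  shows "aw_params (complex_of_real q) a b c d"
proof
  fix n
  have "aw_C (complex_of_real q) a b c d (Suc n) \<noteq> 0"
    using C[of "Suc n"] by auto
  then show "1 - a * b * complex_of_real q ^ n \<noteq> 0" "1 - a * c * complex_of_real q ^ n \<noteq> 0"
      "1 - a * d * complex_of_real q ^ n \<noteq> 0"
    unfolding aw_C_def Let_def by (auto simp: mult_ac)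
  show "1 - a * b * c * d * complex_of_real q ^ n \<noteq> 0"
    using e4[of n] assms(1) by (auto simp: power_int_minus field_simps)
  have "q * q ^ n < 1"
    using power_Suc_less_one[of q n] assms by simp
  then have "1 - q * q ^ n \<noteq> 0" by simp
  then have "complex_of_real (1 - q * q ^ n) \<noteq> 0" unfolding of_real_eq_0_iff .
  then show "1 - complex_of_real q * complex_of_real q ^ n \<noteq> 0" by simp
qed (use assms in auto)

text \<open>
  The algebraic counterpart of Favard's theorem. Reality of the \<open>B\<^sub>n\<close> and
  \<open>C\<^sub>n\<close> passes to the coefficients of the \<open>P\<^sub>n\<close> through the recurrence,
  although the parameters in the explicit series need not be real.
\<close>

lemma aw_form_positive_definite:
  fixes q :: real
  assumes "0 < q" "q < 1" "a \<noteq> 0"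
    and "\<And>m::nat. a * b * c * d \<noteq> complex_of_real q powi (- int m)"
    and B: "\<And>n. aw_B (complex_of_real q) a b c d n \<in> \<real>"
    and C: "\<And>n. n \<ge> 1 \<Longrightarrow> 0 < aw_C (complex_of_real q) a b c d n"
  shows "positive_definite_form_on (\<lambda>r f. lconst r * f)
      real_sym_laurent (aw_form (complex_of_real q) a b c d)"
proof -
  let ?P = "aw_P (complex_of_real q) a b c d" and ?h = "aw_h (complex_of_real q) a b c d"
  interpret aw: aw_params "complex_of_real q" a b c d
    using assms by (intro aw_params_of_positive)
  interpret monic_sym_family ?P
    using aw.aw_P_0 aw.aw_P_1 aw.aw_P_recurrence by (rule three_term_recurrence_monic_sym)
  have "aw_form (complex_of_real q) a b c d = diag_form ?h"
    unfolding aw_form_def is_aw_form_def by (rule the_orthogonal_form)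
  moreover have "?P n \<in> real_sym_laurent" for n
  proof -
    have "aw_C (complex_of_real q) a b c d (Suc n) \<in> \<real>" for n
      using C[of "Suc n"] by (auto simp: complex_is_Real_iff less_complex_def)
    with aw.aw_P_0 aw.aw_P_1 aw.aw_P_recurrence B
    have "Poly_Mapping.lookup (?P n) k \<in> \<real>" for k
      by (rule three_term_recurrence_real)
    then show ?thesis using sym[of n] by (simp add: real_sym_laurent_def)
  qed
  moreover have "0 < ?h n" for n
  proof (induction n)
    case (Suc n)
    have "?h (Suc n) = ?h n * aw_C (complex_of_real q) a b c d (Suc n)"
      by (simp add: aw_h_def mult.commute)
    then show ?case using Suc C[of "Suc n"] by (simp add: complex_pos_mult)
  qed (simp add: aw_h_def less_complex_def)
  ultimately show ?thesis using diag_form_positive_definite by simp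
qed

section \<open>Reality of the parameter product cd\<close>

text \<open>
  The argument of \<open>s n\<close> is independent of \<open>n\<close>, and by continuity of
  \<^const>\<open>sgn\<close> away from 0 it is that of the limit.
\<close>

lemma positive_limit_of_positive_ratios:
  fixes s :: "nat \<Rightarrow> complex"
  assumes "s \<longlonglongrightarrow> 1" and "\<And>n. 0 < s (Suc n) / s n"
  shows "0 < s 0"
proof -
  have const: "sgn (s n) = sgn (s 0)" for n
  proof (induction n)
    case (Suc n)
    obtain r where r: "0 < r" "s (Suc n) / s n = complex_of_real r"
      using assms(2)[of n] complex_pos_iff by auto
    then have "s n \<noteq> 0" by auto
    with r(2) have "s (Suc n) = complex_of_real r * s n" by (simp add: field_simps)
    then show ?case using r(1) Suc by (simp add: sgn_mult sgn_of_real)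
  qed simp
  have "(\<lambda>n. sgn (s n)) \<longlonglongrightarrow> sgn 1"
    using assms(1) by (intro tendsto_sgn) auto
  then have "(\<lambda>n::nat. sgn (s 0)) \<longlonglongrightarrow> 1"
    by (subst (asm) const) simp
  then have "sgn (s 0) = 1"
    by (simp add: LIMSEQ_const_iff)
  then have "s 0 = complex_of_real (norm (s 0))" "s 0 \<noteq> 0"
    by (auto simp: sgn_eq field_simps)
  then show ?thesis unfolding complex_pos_iff by (metis zero_less_norm_iff)
qed

text \<open>
  In \<open>C\<^sub>n\<^sub>+\<^sub>1(a,b,c,d) / C\<^sub>n(qa,qb,c,d)\<close> the denominators and the four
  factors containing \<open>ac, ad, bc, bd\<close> cancel. As \<open>ab\<close> is real and negative, what
  remains is a positive multiple of \<open>s n / s (n - 1)\<close> with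
  \<open>s n = (1 - q\<^sup>n cd) / (1 - q\<^sup>n abcd)\<close>. Since \<open>s\<close> tends to 1,
  \<open>\<sigma> = s 0\<close> is positive, and solving \<open>1 - cd = \<sigma> (1 - ab cd)\<close> gives
  \<open>cd = (1 - \<sigma>) / (1 - \<sigma> ab)\<close>.
\<close>

lemma cd_real_of_positive_coefficients:
  fixes q :: real and a b c d :: complex
  assumes q: "0 < q" "q < 1"
    and e4: "\<And>m::nat. a * b * c * d \<noteq> complex_of_real q powi (- int m)"
    and C: "\<And>n. n \<ge> 1 \<Longrightarrow> 0 < aw_C (complex_of_real q) a b c d n"
    and C': "\<And>n. n \<ge> 1 \<Longrightarrow>
           0 < aw_C (complex_of_real q) (complex_of_real q * a) (complex_of_real q * b) c d n"
    and "a * b < 0"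
  shows "\<exists>t y. a * b = complex_of_real t \<and> c * d = complex_of_real y \<and> t < 0 \<and> y < 1 \<and> t * y < 1"
proof -
  define Q where "Q = complex_of_real q"
  define t where "t = Re (a * b)"
  have t: "a * b = complex_of_real t" "t < 0"
    using \<open>a * b < 0\<close> by (auto simp: t_def less_complex_def complex_eq_iff)
  define E where "E = a * b * c * d"
  have E: "E = complex_of_real t * (c * d)" by (simp add: E_def t(1)[symmetric])
  have Enz: "1 - Q ^ n * E \<noteq> 0" for n
    using e4[of n] q(1) by (auto simp: E_def Q_def power_int_minus field_simps)
  define s where "s n = (1 - Q ^ n * (c * d)) / (1 - Q ^ n * E)" for n
  have "(\<lambda>n. Q ^ n) \<longlonglongrightarrow> 0"
    unfolding Q_def using q by (intro LIMSEQ_power_zero) simp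
  then have "s \<longlonglongrightarrow> (1 - 0 * (c * d)) / (1 - 0 * E)"
    unfolding s_def by (intro tendsto_divide tendsto_diff tendsto_mult tendsto_const) auto
  then have lim: "s \<longlonglongrightarrow> 1" by simp
  have ratio: "0 < s (Suc n) / s n" for n
  proof -
    define x where "x = Q ^ n"
    define M where "M =
        (1 - Q * x * (a * c)) * (1 - Q * x * (a * d)) * (1 - Q * x * (b * c)) * (1 - Q * x * (b * d))"
    have e: "2 * Suc (Suc n) - 3 = Suc (2 * n)" "2 * Suc (Suc n) - 2 = Suc (Suc (2 * n))"
      "2 * Suc (Suc n) - 1 = Suc (Suc (Suc (2 * n)))" by auto
    \<comment> \<open>the common denominator of both coefficients\<close>
    define K where "K =
        (1 - Q ^ Suc (2 * n) * E) * (1 - Q ^ Suc (Suc (2 * n)) * E) ^ 2 *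
            (1 - Q ^ Suc (Suc (Suc (2 * n))) * E)"
    have "K \<noteq> 0" using Enz by (simp only: K_def mult_eq_0_iff power_eq_0_iff) simp
    define u where "u = aw_C Q a b c d (Suc (Suc n))"
    define u' where "u' = aw_C Q (Q * a) (Q * b) c d (Suc n)"
    have pos: "0 < u" "0 < u'" using C C' by (auto simp: u_def u'_def Q_def)
    have u: "u = (1 - Q * x * (a * b)) * M * (1 - Q * x * (c * d)) * (1 - Q * (Q * x)) *
        (1 - x * E) / K"
      unfolding u_def aw_C_def Let_def K_def M_def E_def[symmetric] e
      by (simp add: x_def[symmetric] mult_ac)
    have u': "u' = (1 - Q * Q * x * (a * b)) * M * (1 - x * (c * d)) * (1 - Q * x) *
        (1 - Q * x * E) / K"
    proof (cases n)
      case 0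
      have "x = 1" "Q ^ Suc 0 = Q" using 0 by (auto simp: x_def)
      show ?thesis
        unfolding u'_def aw_C_def Let_def K_def M_def E_def 0 \<open>x = 1\<close>
        using Enz[of 1] by (simp add: E_def power2_eq_square power3_eq_cube mult_ac)
    next
      case (Suc m)
      have y: "x = Q * Q ^ m" by (simp add: x_def Suc)
      have e: "2 * Suc n - 3 = Suc (2 * m)" "2 * Suc n - 2 = Suc (Suc (2 * m))"
        "2 * Suc n - 1 = Suc (Suc (Suc (2 * m)))" "2 * n = Suc (Suc (2 * m))" "Suc n - 2 =
          m" "Suc n - 1 = n" "(Suc n = 1) = False"
        using Suc by auto
      show ?thesis
        unfolding u'_def aw_C_def Let_def K_def M_def E_def e if_False x_def[symmetric] power_Suc
            unfolding y
        by (simp add: mult_ac)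
    qed
    have nz: "M \<noteq> 0" "1 - Q * x * (c * d) \<noteq> 0" "1 - x * (c * d) \<noteq> 0" "1 - x * E \<noteq> 0" "1 - Q * x * E \<noteq> 0"
        "1 - Q * (Q * x) \<noteq> 0" "1 - Q * x \<noteq> 0" "1 - Q * x * (a * b) \<noteq> 0" "1 - Q * Q * x * (a * b) \<noteq> 0"
      using pos u u' by auto
    have "u / u' * ((1 - Q * Q * x * (a * b)) * (1 - Q * x) /
        ((1 - Q * x * (a * b)) * (1 - Q * (Q * x)))) =
        (1 - Q * x * (c * d)) * (1 - x * E) / ((1 - Q * x * E) * (1 - x * (c * d)))"
      unfolding u u' using nz \<open>K \<noteq> 0\<close> by (simp add: divide_simps)
    also have "\<dots> = s (Suc n) / s n"
      unfolding s_def power_Suc x_def[symmetric] by (simp add: mult_ac)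
    finally have eq: "s (Suc n) / s n = u / u' *
        ((1 - Q * Q * x * (a * b)) * (1 - Q * x) / ((1 - Q * x * (a * b)) * (1 - Q * (Q * x))))" ..
    define r where "r = q ^ n"
    have xr: "x = complex_of_real r" by (simp add: x_def Q_def r_def)
    have r: "0 < r" "q * r < 1" "q * (q * r) < 1"
      using q power_Suc_less_one[of q n] power_Suc_less_one[of q "Suc n"] by (auto simp: r_def)
    have tn: "q * r * t < 0" "q * q * r * t < 0" using q r t(2) by (auto simp: mult_pos_neg)
    have "0 < (1 - q * q * r * t) * (1 - q * r) / ((1 - q * r * t) * (1 - q * (q * r)))"
      using r tn by (intro divide_pos_pos mult_pos_pos) auto
    then have "0 < complex_of_real ((1 - q * q * r * t) * (1 - q * r) /
        ((1 - q * r * t) * (1 - q * (q * r))))"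
      by (simp add: less_complex_def)
    also have "\<dots> =
        (1 - Q * Q * x * (a * b)) * (1 - Q * x) / ((1 - Q * x * (a * b)) * (1 - Q * (Q * x)))"
      unfolding xr t(1) Q_def by simp
    finally show ?thesis
      unfolding eq by (rule complex_pos_mult[OF complex_pos_divide[OF pos]])
  qed
  from positive_limit_of_positive_ratios[OF lim ratio]
  obtain \<sigma> where \<sigma>: "0 < \<sigma>" "s 0 = complex_of_real \<sigma>" using complex_pos_iff by auto
  have st: "1 - \<sigma> * t > 0" using mult_pos_neg[OF \<sigma>(1) t(2)] by simp
  define y where "y = (1 - \<sigma>) / (1 - \<sigma> * t)"
  have "1 - c * d = complex_of_real \<sigma> * (1 - E)"
    using \<sigma>(2) Enz[of 0] by (simp add: s_def field_simps)
  then have "c * d * complex_of_real (1 - \<sigma> * t) = complex_of_real (1 - \<sigma>)"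
    unfolding E by (simp add: algebra_simps)
  then have y: "c * d = complex_of_real y"
    unfolding y_def of_real_divide using st
    by (metis nonzero_eq_divide_eq of_real_eq_0_iff less_irrefl)
  have "y < 1" unfolding y_def using st mult_pos_neg[OF \<sigma>(1) t(2)] \<sigma> t
      by (simp add: mult_less_cancel_left)
  moreover have "t * y < 1"
    unfolding y_def using st t by (simp add: algebra_simps)
  ultimately show ?thesis using t y by blast
qed

section \<open>The form on pairs\<close>

lemma positive_definite_direct_sum:
  fixes F G :: "laurent \<Rightarrow> laurent \<Rightarrow> complex"
  assumes F: "positive_definite_form_on (\<lambda>r f. lconst r * f) V F"
    and G: "positive_definite_form_on (\<lambda>r f. lconst r * f) V G"
    and "0 \<in> V" and w: "0 < w"
  shows "positive_definite_form_on (\<lambda>r u. (lconst r * fst u, lconst r * snd u)) (V \<times> V)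
    (\<lambda>u v. F (fst u) (fst v) + w * G (snd u) (snd v))"
proof -
  have wr: "w \<in> \<real>" using w by (auto simp: complex_is_Real_iff less_complex_def)
  have z: "H 0 0 = 0" if "positive_definite_form_on (\<lambda>r f. lconst r * f) V H" for H
  proof -
    have "H (lconst 0 * 0) 0 = 0 * H 0 0"
      using that \<open>0 \<in> V\<close> unfolding positive_definite_form_on_def bilinear_form_on_def
      by (meson Reals_0)
    then show ?thesis by simp
  qed
  have nn: "0 < H f f \<or> f = 0 \<and> H f f = 0"
    if "positive_definite_form_on (\<lambda>r f. lconst r * f) V H" "f \<in> V" for H f
    using that z[OF that(1)] by (cases "f = 0") (auto simp: positive_definite_form_on_def)
  have add: "0 < x + w * y" if "0 < x \<or> x = 0" "0 < y \<or> y = 0" "0 < x \<or> 0 < y" for x y :: complex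
    using that w by (auto simp: less_complex_def intro: add_pos_pos)
  show ?thesis
    unfolding positive_definite_form_on_def
  proof (intro conjI ballI impI)
    show "F (fst u) (fst v) + w * G (snd u) (snd v) \<in> \<real>"
        "F (fst u) (fst v) + w * G (snd u) (snd v) = F (fst v) (fst u) + w * G (snd v) (snd u)"
      if "u \<in> V \<times> V" "v \<in> V \<times> V" for u v
      using F G that wr unfolding positive_definite_form_on_def by (auto simp: mem_Times_iff)
    show "bilinear_form_on \<real> (\<lambda>r u. (lconst r * fst u, lconst r * snd u)) (V \<times> V)
        (\<lambda>u v. F (fst u) (fst v) + w * G (snd u) (snd v))"
      using F G unfolding positive_definite_form_on_def bilinear_form_on_def
      by (auto simp: mem_Times_iff algebra_simps)
    show "0 < F (fst u) (fst u) + w * G (snd u) (snd u)" if "u \<in> V \<times> V" "u \<noteq> 0" for u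
      using nn[OF F, of "fst u"] nn[OF G, of "snd u"] that
      by (intro add) (auto simp: mem_Times_iff prod_eq_iff)
  qed
qed

theorem proposition5p1:
  fixes q :: real and a b c d :: complex
  assumes "0 < q" and "q < 1"
    and "a \<noteq> 0" and "b \<noteq> 0" and "c \<noteq> 0" and "d \<noteq> 0"
    and "\<And>m::nat. a * b * c * d \<noteq> complex_of_real q powi (- int m)"
    and "{a, b} \<inter> {inverse a, inverse b} = {}"
    and "\<And>n. aw_B (complex_of_real q) a b c d n \<in> \<real>"
    and "\<And>n. n \<ge> 1 \<Longrightarrow> 0 < aw_C (complex_of_real q) a b c d n"
    and "\<And>n. aw_B (complex_of_real q) (complex_of_real q * a) (complex_of_real q * b) c d n \<in> \<real>"
    and "\<And>n. n \<ge> 1 \<Longrightarrow>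
           0 < aw_C (complex_of_real q) (complex_of_real q * a) (complex_of_real q * b) c d n"
    and "a * b < 0"
  shows "(c * d \<in> \<real> \<and> c * d < 1) \<and>
    (\<forall>n::nat. n \<ge> 1 \<longrightarrow>
       a * b * (1 - complex_of_real q ^ n) * (1 - complex_of_real q ^ (n - 1) * (c * d)) /
       ((1 - complex_of_real q ^ n * (a * b)) * (1 - complex_of_real q ^ (n - 1) * (a * b * c * d)))
       \<in> \<real>) \<and>
    positive_definite_form_on (\<lambda>r u. (lconst r * fst u, lconst r * snd u))
      (real_sym_laurent \<times> real_sym_laurent) (pair_form (complex_of_real q) a b c d)"
proof (intro conjI allI impI)
  define Q where "Q = complex_of_real q"
  obtain t y where t: "a * b = complex_of_real t" "t < 0" and y: "c * d = complex_of_real y" "y < 1"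
    and ty: "t * y < 1"
    using cd_real_of_positive_coefficients[OF assms(1,2,7,10,12,13)] by blast
  have e4: "a * b * c * d = complex_of_real (t * y)"
    by (simp add: t(1)[symmetric] y(1)[symmetric])
  show "c * d \<in> \<real>" "c * d < 1" using y by (simp_all add: less_complex_def)
  show "a * b * (1 - complex_of_real q ^ n) * (1 - complex_of_real q ^ (n - 1) * (c * d)) /
       ((1 - complex_of_real q ^ n * (a * b)) * (1 - complex_of_real q ^ (n - 1) * (a * b * c * d)))
       \<in> \<real>" for n
    unfolding e4 unfolding t(1) y(1)
    by (intro Reals_divide Reals_mult Reals_diff Reals_power Reals_1 Reals_of_real)
  define N where "N = (1 - a * c) * (1 - a * d) * (1 - b * c) * (1 - b * d)"
  define w where "w =
      - (a * b * ((1 - a * b) * (1 - Q * a * b) * (1 - a * c) * (1 - a * d) * (1 - b * c) *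
          (1 - b * d) /
              ((1 - a * b * c * d) * (1 - Q * a * b * c * d))))"
  \<comment> \<open>\<open>w\<close> is \<open>C\<^sub>1 > 0\<close> times a real factor that is positive because
    \<open>cd < 1\<close> and \<open>abcd < 1\<close>\<close>
  have "0 < w"
  proof -
    define K where "K = (- t) * ((1 - q * t) * (1 - t * y) / ((1 - y) * (1 - q)))"
    have "q * t < 0" using assms(1) t(2) by (simp add: mult_pos_neg)
    then have "0 < K" unfolding K_def
      using assms(1,2) t y ty by (intro mult_pos_pos divide_pos_pos) auto
    then have "0 < complex_of_real K" by (simp add: less_complex_def)
    moreover have "w = complex_of_real K * aw_C Q a b c d 1"
    proof -
      have C1: "aw_C Q a b c d 1 = (1 - complex_of_real t) * N * (1 - complex_of_real y) * (1 - Q) /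
          ((1 - complex_of_real (t * y))\<^sup>2 * (1 - Q * complex_of_real (t * y)))"
        unfolding aw_C_def Let_def e4 y(1) N_def by (simp add: t(1) mult_ac)
      have w: "w = - (complex_of_real t * ((1 - complex_of_real t) * (1 - Q * complex_of_real t) * N /
          ((1 - complex_of_real (t * y)) * (1 - Q * complex_of_real (t * y)))))"
        unfolding w_def N_def e4[symmetric] t(1)[symmetric] by (simp only: mult_ac)
      have "complex_of_real (1 - t * y) \<noteq> 0" "complex_of_real (1 - y) \<noteq> 0" "complex_of_real (1 - q) \<noteq> 0"
        using ty y assms(2) by (simp_all only: of_real_eq_0_iff)
      then have nz: "1 - complex_of_real (t * y) \<noteq> 0" "1 - complex_of_real y \<noteq> 0" "1 - Q \<noteq> 0"
        by (simp_all add: Q_def)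
      have K: "complex_of_real K =
          - complex_of_real t * ((1 - Q * complex_of_real t) * (1 - complex_of_real (t * y)) /
          ((1 - complex_of_real y) * (1 - Q)))"
        by (simp add: K_def Q_def)
      show ?thesis
        unfolding w C1 K using nz by (simp add: power2_eq_square del: of_real_mult)
    qed
    ultimately show ?thesis using assms(10)[of 1] unfolding Q_def by (simp add: complex_pos_mult)
  qed
  have F: "positive_definite_form_on (\<lambda>r f. lconst r * f) real_sym_laurent (aw_form Q a b c d)"
    unfolding Q_def using assms by (intro aw_form_positive_definite)
  have "Q * a * (Q * b) * c * d \<noteq> Q powi (- int m)" for m
  proof
    assume "Q * a * (Q * b) * c * d = Q powi (- int m)"
    have p: "Q powi (- int m) = inverse (Q ^ m)"
        "Q powi (- int (Suc (Suc m))) = inverse (Q * (Q * Q ^ m))"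
      by (simp_all only: power_int_minus power_int_of_nat power_Suc)
    have "Q \<noteq> 0" using assms(1) by (simp add: Q_def)
    have "Q * (Q * (a * b * c * d)) = inverse (Q ^ m)"
      using \<open>Q * a * (Q * b) * c * d = Q powi (- int m)\<close> unfolding p(1) by (simp add: mult_ac)
    then have "a * b * c * d = inverse (Q * (Q * Q ^ m))"
      using \<open>Q \<noteq> 0\<close> by (simp add: field_simps)
    then have "a * b * c * d = Q powi (- int (Suc (Suc m)))"
      by (simp only: p(2))
    with assms(7)[of "Suc (Suc m)"] show False by (simp add: Q_def)
  qed
  then have G: "positive_definite_form_on (\<lambda>r f. lconst r * f)
      real_sym_laurent (aw_form Q (Q * a) (Q * b) c d)"
    unfolding Q_def using assms by (intro aw_form_positive_definite) auto
  have "pair_form Q a b c d =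
      (\<lambda>u v. aw_form Q a b c d (fst u) (fst v) + w * aw_form Q (Q * a) (Q * b) c d (snd u) (snd v))"
    by (simp add: fun_eq_iff pair_form_def w_def)
  then show "positive_definite_form_on (\<lambda>r u. (lconst r * fst u, lconst r * snd u))
      (real_sym_laurent \<times> real_sym_laurent) (pair_form (complex_of_real q) a b c d)"
    using positive_definite_direct_sum[OF F G _ \<open>0 < w\<close>]
    by (simp add: Q_def real_sym_laurent_def sym_laurent_def)
qed

end
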